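(* Let $H$ be a Hopf algebra, $C$ a right $H$-module coalgebra, and let $f\colon C\to H$ be a total cointegral which is a coalgebra map, with convolution inverse $f^{-1}=S\circ f$. Then $C$ is a right-right Yetter-Drinfeld module over $H$ by the original action of $H$ and the coaction $$c\longmapsto c^{(2)}\otimes f^{-1}(c^{(1)})f(c^{(3)}).$$
   Context: All Hopf algebras, algebras and coalgebras are over a field; every Hopf algebra $H$ has an invertible antipode $S$. Sweedler notation: $\Delta(c)=c^{(1)}\otimes c^{(2)}$; right coactions are $m\mapsto m_{\langle 0\rangle}\otimes m_{\langle 1\rangle}$. For a right $H$-module coalgebra $C$, a total cointegral is a linear map $f\colon C\to H$ with $\varepsilon(f(c))=\varepsilon(c)$ and $f(ch)=f(c)h$. A right $H$-module and right $H$-comodule $M$ (coaction $\rho$) is a right-right Yetter-Drinfeld module if $\rho(mh)=m_{\langle 0\rangle}h^{(2)}\otimes S(h^{(1)})m_{\langle 1\rangle}h^{(3)}$ for all $m,h$. *)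

theory Defs
  imports Complex_Main "HOL-Library.Poly_Mapping"
begin

text \<open>
  Vector spaces over a field are given as in \<^theory>\<open>HOL.Vector_Spaces\<close>: a scalar multiplication on an
  abelian group type.  A tensor product is the usual quotient of the free vector space on the
  tuples (formal sums, \<open>('v \<times> 'w) \<Rightarrow>\<^sub>0 'k\<close>) by the subspace spanned by the multilinearity relations;
  a tensor is a coset of that subspace, i.e. the set of all formal sums representing it.
\<close>

subsection \<open>Tensor products\<close>

definition fscale :: "'k::field \<Rightarrow> ('a \<Rightarrow>\<^sub>0 'k) \<Rightarrow> ('a \<Rightarrow>\<^sub>0 'k)" where
  "fscale a = Poly_Mapping.map (\<lambda>b. a * b)"

definition lin_ext :: "('k::field \<Rightarrow> 'u \<Rightarrow> 'u::ab_group_add) \<Rightarrow> ('a \<Rightarrow> 'u) \<Rightarrow> ('a \<Rightarrow>\<^sub>0 'k) \<Rightarrow> 'u" where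
  "lin_ext s \<phi> x = (\<Sum>p\<in>Poly_Mapping.keys x. s (Poly_Mapping.lookup x p) (\<phi> p))"

text \<open>\<open>K\<close> is a tuple with one slot left open; these relations make that slot linear.\<close>

definition slot_relations ::
  "('k::field \<Rightarrow> 'v \<Rightarrow> 'v::ab_group_add) \<Rightarrow> ('v \<Rightarrow> 'a) \<Rightarrow> ('a \<Rightarrow>\<^sub>0 'k) set" where
  "slot_relations s K =
     {Poly_Mapping.single (K (u + v)) 1 - Poly_Mapping.single (K u) 1 - Poly_Mapping.single (K v) 1
       | u v. True}
   \<union> {Poly_Mapping.single (K (s a v)) 1 - fscale a (Poly_Mapping.single (K v) 1) | a v. True}"

definition rel2 ::
  "('k::field \<Rightarrow> 'v \<Rightarrow> 'v::ab_group_add) \<Rightarrow> ('k \<Rightarrow> 'w \<Rightarrow> 'w::ab_group_add)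
   \<Rightarrow> (('v \<times> 'w) \<Rightarrow>\<^sub>0 'k) set" where
  "rel2 sV sW = module.span fscale
     ((\<Union>w. slot_relations sV (\<lambda>v. (v, w))) \<union> (\<Union>v. slot_relations sW (\<lambda>w. (v, w))))"

definition rel3 ::
  "('k::field \<Rightarrow> 'u \<Rightarrow> 'u::ab_group_add) \<Rightarrow> ('k \<Rightarrow> 'v \<Rightarrow> 'v::ab_group_add)
   \<Rightarrow> ('k \<Rightarrow> 'w \<Rightarrow> 'w::ab_group_add) \<Rightarrow> (('u \<times> 'v \<times> 'w) \<Rightarrow>\<^sub>0 'k) set" where
  "rel3 sU sV sW = module.span fscale
     ((\<Union>v w. slot_relations sU (\<lambda>u. (u, v, w)))
    \<union> (\<Union>u w. slot_relations sV (\<lambda>v. (u, v, w)))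
    \<union> (\<Union>u v. slot_relations sW (\<lambda>w. (u, v, w))))"

definition tclass :: "('a \<Rightarrow>\<^sub>0 'k::field) set \<Rightarrow> ('a \<Rightarrow>\<^sub>0 'k) \<Rightarrow> ('a \<Rightarrow>\<^sub>0 'k) set" where
  "tclass R x = {y. y - x \<in> R}"

definition tpure :: "('a \<Rightarrow>\<^sub>0 'k::field) set \<Rightarrow> 'a \<Rightarrow> ('a \<Rightarrow>\<^sub>0 'k) set" where
  "tpure R p = tclass R (Poly_Mapping.single p 1)"

definition linear_to_tensor ::
  "('k::field \<Rightarrow> 'v \<Rightarrow> 'v::ab_group_add) \<Rightarrow> ('a \<Rightarrow>\<^sub>0 'k) set \<Rightarrow> ('v \<Rightarrow> ('a \<Rightarrow>\<^sub>0 'k) set) \<Rightarrow> bool" where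
  "linear_to_tensor s R D \<longleftrightarrow>
     (\<forall>v. D v \<in> range (tclass R))
   \<and> (\<forall>u v. \<forall>x\<in>D u. \<forall>y\<in>D v. x + y \<in> D (u + v))
   \<and> (\<forall>a v. \<forall>x\<in>D v. fscale a x \<in> D (s a v))"

text \<open>
  Sweedler notation.  For a tensor \<open>T\<close> represented by \<open>\<Sum>\<^sub>i a\<^sub>i \<cdot> p\<^sub>i\<close> (the \<open>p\<^sub>i\<close> being tuples) and \<open>\<phi>\<close>
  multilinear with values in a vector space, \<open>tsum s \<phi> T\<close> is the element \<open>\<Sum>\<^sub>i a\<^sub>i \<phi>(p\<^sub>i)\<close>, which does not
  depend on the representative.  \<open>ttsum R \<Phi> T\<close> is the same for \<open>\<Phi>\<close> with values in the
  tensor product with relations \<open>R\<close>: one picks representatives \<open>g p\<close> of the tensors \<open>\<Phi> p\<close>.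
\<close>

definition tsum ::
  "('k::field \<Rightarrow> 'u \<Rightarrow> 'u::ab_group_add) \<Rightarrow> ('a \<Rightarrow> 'u) \<Rightarrow> ('a \<Rightarrow>\<^sub>0 'k) set \<Rightarrow> 'u" where
  "tsum s \<phi> T = the_elem (lin_ext s \<phi> ` T)"

definition ttsum ::
  "('b \<Rightarrow>\<^sub>0 'k::field) set \<Rightarrow> ('a \<Rightarrow> ('b \<Rightarrow>\<^sub>0 'k) set) \<Rightarrow> ('a \<Rightarrow>\<^sub>0 'k) set \<Rightarrow> ('b \<Rightarrow>\<^sub>0 'k) set" where
  "ttsum R \<Phi> T = (\<Union>x\<in>T. \<Union>g\<in>{g. \<forall>p. g p \<in> \<Phi> p}. tclass R (lin_ext fscale g x))"


subsection \<open>Hopf algebras\<close>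

text \<open>Iterated comultiplication \<open>c \<mapsto> c\<^sup>(\<^sup>1\<^sup>) \<otimes> c\<^sup>(\<^sup>2\<^sup>) \<otimes> c\<^sup>(\<^sup>3\<^sup>)\<close>, computed as \<open>(\<Delta> \<otimes> id) \<Delta>\<close>.\<close>

definition comult3 ::
  "('k::field \<Rightarrow> 'c \<Rightarrow> 'c::ab_group_add) \<Rightarrow> ('c \<Rightarrow> (('c \<times> 'c) \<Rightarrow>\<^sub>0 'k) set)
   \<Rightarrow> 'c \<Rightarrow> (('c \<times> 'c \<times> 'c) \<Rightarrow>\<^sub>0 'k) set" where
  "comult3 s \<Delta> c =
     ttsum (rel3 s s s) (\<lambda>(x, y). ttsum (rel3 s s s) (\<lambda>(x1, x2). tpure (rel3 s s s) (x1, x2, y)) (\<Delta> x))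
       (\<Delta> c)"

locale k_coalgebra = vector_space s
  for s :: "'k::field \<Rightarrow> 'c \<Rightarrow> 'c::ab_group_add" +
  fixes \<Delta> :: "'c \<Rightarrow> (('c \<times> 'c) \<Rightarrow>\<^sub>0 'k) set"
    and \<epsilon> :: "'c \<Rightarrow> 'k"
  assumes comult_linear: "linear_to_tensor s (rel2 s s) \<Delta>"
    and counit_linear: "Vector_Spaces.linear s (*) \<epsilon>"
    and coassoc: "comult3 s \<Delta> c =
      ttsum (rel3 s s s) (\<lambda>(x, y). ttsum (rel3 s s s) (\<lambda>(y1, y2). tpure (rel3 s s s) (x, y1, y2)) (\<Delta> y))
        (\<Delta> c)"
    and counit_left: "tsum s (\<lambda>(x, y). s (\<epsilon> x) y) (\<Delta> c) = c"
    and counit_right: "tsum s (\<lambda>(x, y). s (\<epsilon> y) x) (\<Delta> c) = c"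

text \<open>The class \<^class>\<open>ring_1\<close> includes \<open>0 \<noteq> 1\<close>; for bialgebras this is no restriction, as \<open>\<epsilon> 1 = 1\<close>.\<close>

locale k_algebra = vector_space s
  for s :: "'k::field \<Rightarrow> 'h \<Rightarrow> 'h::ring_1" +
  assumes scale_mult_left: "s a x * y = s a (x * y)"
    and scale_mult_right: "x * s a y = s a (x * y)"

locale hopf_algebra = k_algebra s + k_coalgebra s \<Delta> \<epsilon>
  for s :: "'k::field \<Rightarrow> 'h \<Rightarrow> 'h::ring_1"
    and \<Delta> :: "'h \<Rightarrow> (('h \<times> 'h) \<Rightarrow>\<^sub>0 'k) set"
    and \<epsilon> :: "'h \<Rightarrow> 'k" +
  fixes S :: "'h \<Rightarrow> 'h"
  assumes comult_mult: "\<Delta> (g * h) =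
      ttsum (rel2 s s) (\<lambda>(g1, g2). ttsum (rel2 s s) (\<lambda>(h1, h2). tpure (rel2 s s) (g1 * h1, g2 * h2)) (\<Delta> h))
        (\<Delta> g)"
    and comult_one: "\<Delta> 1 = tpure (rel2 s s) (1, 1)"
    and counit_mult: "\<epsilon> (g * h) = \<epsilon> g * \<epsilon> h"
    and counit_one: "\<epsilon> 1 = 1"
    and antipode_linear: "Vector_Spaces.linear s s S"
    and antipode_left: "tsum s (\<lambda>(h1, h2). S h1 * h2) (\<Delta> h) = s (\<epsilon> h) 1"
    and antipode_right: "tsum s (\<lambda>(h1, h2). h1 * S h2) (\<Delta> h) = s (\<epsilon> h) 1"
    and antipode_bij: "bij S"


subsection \<open>Modules, comodules, cointegrals\<close>

locale right_module = k_algebra sH + M: vector_space sM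
  for sH :: "'k::field \<Rightarrow> 'h \<Rightarrow> 'h::ring_1"
    and sM :: "'k \<Rightarrow> 'm \<Rightarrow> 'm::ab_group_add" +
  fixes act :: "'m \<Rightarrow> 'h \<Rightarrow> 'm"
  assumes act_linear_left: "Vector_Spaces.linear sM sM (\<lambda>m. act m h)"
    and act_linear_right: "Vector_Spaces.linear sH sM (\<lambda>h. act m h)"
    and act_one: "act m 1 = m"
    and act_mult: "act m (g * h) = act (act m g) h"

locale module_coalgebra =
  hopf_algebra sH \<Delta>H \<epsilon>H S + right_module sH sC act + C: k_coalgebra sC \<Delta>C \<epsilon>C
  for sH :: "'k::field \<Rightarrow> 'h \<Rightarrow> 'h::ring_1"
    and \<Delta>H :: "'h \<Rightarrow> (('h \<times> 'h) \<Rightarrow>\<^sub>0 'k) set"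
    and \<epsilon>H :: "'h \<Rightarrow> 'k"
    and S :: "'h \<Rightarrow> 'h"
    and sC :: "'k \<Rightarrow> 'c \<Rightarrow> 'c::ab_group_add"
    and \<Delta>C :: "'c \<Rightarrow> (('c \<times> 'c) \<Rightarrow>\<^sub>0 'k) set"
    and \<epsilon>C :: "'c \<Rightarrow> 'k"
    and act :: "'c \<Rightarrow> 'h \<Rightarrow> 'c" +
  assumes comult_act: "\<Delta>C (act c h) =
      ttsum (rel2 sC sC)
        (\<lambda>(c1, c2). ttsum (rel2 sC sC) (\<lambda>(h1, h2). tpure (rel2 sC sC) (act c1 h1, act c2 h2)) (\<Delta>H h))
        (\<Delta>C c)"
    and counit_act: "\<epsilon>C (act c h) = \<epsilon>C c * \<epsilon>H h"

definition total_cointegral ::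
  "('k::field \<Rightarrow> 'h \<Rightarrow> 'h::ring_1) \<Rightarrow> ('h \<Rightarrow> 'k) \<Rightarrow> ('k \<Rightarrow> 'c \<Rightarrow> 'c::ab_group_add) \<Rightarrow> ('c \<Rightarrow> 'k)
   \<Rightarrow> ('c \<Rightarrow> 'h \<Rightarrow> 'c) \<Rightarrow> ('c \<Rightarrow> 'h) \<Rightarrow> bool" where
  "total_cointegral sH \<epsilon>H sC \<epsilon>C act f \<longleftrightarrow>
     Vector_Spaces.linear sC sH f \<and> (\<forall>c. \<epsilon>H (f c) = \<epsilon>C c) \<and> (\<forall>c h. f (act c h) = f c * h)"

definition coalgebra_map ::
  "('k::field \<Rightarrow> 'c \<Rightarrow> 'c::ab_group_add) \<Rightarrow> ('c \<Rightarrow> (('c \<times> 'c) \<Rightarrow>\<^sub>0 'k) set) \<Rightarrow> ('c \<Rightarrow> 'k)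
   \<Rightarrow> ('k \<Rightarrow> 'd \<Rightarrow> 'd::ab_group_add) \<Rightarrow> ('d \<Rightarrow> (('d \<times> 'd) \<Rightarrow>\<^sub>0 'k) set) \<Rightarrow> ('d \<Rightarrow> 'k)
   \<Rightarrow> ('c \<Rightarrow> 'd) \<Rightarrow> bool" where
  "coalgebra_map sC \<Delta>C \<epsilon>C sD \<Delta>D \<epsilon>D f \<longleftrightarrow>
     Vector_Spaces.linear sC sD f
   \<and> (\<forall>c. \<Delta>D (f c) = ttsum (rel2 sD sD) (\<lambda>(c1, c2). tpure (rel2 sD sD) (f c1, f c2)) (\<Delta>C c))
   \<and> (\<forall>c. \<epsilon>D (f c) = \<epsilon>C c)"

definition convolution_inverse ::
  "('k::field \<Rightarrow> 'c \<Rightarrow> 'c::ab_group_add) \<Rightarrow> ('c \<Rightarrow> (('c \<times> 'c) \<Rightarrow>\<^sub>0 'k) set) \<Rightarrow> ('c \<Rightarrow> 'k)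
   \<Rightarrow> ('k \<Rightarrow> 'h \<Rightarrow> 'h::ring_1) \<Rightarrow> ('c \<Rightarrow> 'h) \<Rightarrow> ('c \<Rightarrow> 'h) \<Rightarrow> bool" where
  "convolution_inverse sC \<Delta>C \<epsilon>C sH f g \<longleftrightarrow>
     Vector_Spaces.linear sC sH g
   \<and> (\<forall>c. tsum sH (\<lambda>(c1, c2). f c1 * g c2) (\<Delta>C c) = sH (\<epsilon>C c) 1)
   \<and> (\<forall>c. tsum sH (\<lambda>(c1, c2). g c1 * f c2) (\<Delta>C c) = sH (\<epsilon>C c) 1)"

locale right_comodule = H: k_coalgebra sH \<Delta>H \<epsilon>H + M: vector_space sM
  for sH :: "'k::field \<Rightarrow> 'h \<Rightarrow> 'h::ab_group_add"
    and \<Delta>H :: "'h \<Rightarrow> (('h \<times> 'h) \<Rightarrow>\<^sub>0 'k) set"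
    and \<epsilon>H :: "'h \<Rightarrow> 'k"
    and sM :: "'k \<Rightarrow> 'm \<Rightarrow> 'm::ab_group_add" +
  fixes \<rho> :: "'m \<Rightarrow> (('m \<times> 'h) \<Rightarrow>\<^sub>0 'k) set"
  assumes coact_linear: "linear_to_tensor sM (rel2 sM sH) \<rho>"
    and coact_coassoc:
      "ttsum (rel3 sM sH sH)
         (\<lambda>(m0, m1). ttsum (rel3 sM sH sH) (\<lambda>(m00, m01). tpure (rel3 sM sH sH) (m00, m01, m1)) (\<rho> m0)) (\<rho> m)
     = ttsum (rel3 sM sH sH)
         (\<lambda>(m0, m1). ttsum (rel3 sM sH sH) (\<lambda>(h1, h2). tpure (rel3 sM sH sH) (m0, h1, h2)) (\<Delta>H m1)) (\<rho> m)"
    and coact_counit: "tsum sM (\<lambda>(m0, m1). sM (\<epsilon>H m1) m0) (\<rho> m) = m"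

locale right_right_yetter_drinfeld =
  hopf_algebra sH \<Delta>H \<epsilon>H S + right_module sH sM act + right_comodule sH \<Delta>H \<epsilon>H sM \<rho>
  for sH :: "'k::field \<Rightarrow> 'h \<Rightarrow> 'h::ring_1"
    and \<Delta>H :: "'h \<Rightarrow> (('h \<times> 'h) \<Rightarrow>\<^sub>0 'k) set"
    and \<epsilon>H :: "'h \<Rightarrow> 'k"
    and S :: "'h \<Rightarrow> 'h"
    and sM :: "'k \<Rightarrow> 'm \<Rightarrow> 'm::ab_group_add"
    and act :: "'m \<Rightarrow> 'h \<Rightarrow> 'm"
    and \<rho> :: "'m \<Rightarrow> (('m \<times> 'h) \<Rightarrow>\<^sub>0 'k) set" +
  assumes yetter_drinfeld: "\<rho> (act m h) =
      ttsum (rel2 sM sH)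
        (\<lambda>(m0, m1). ttsum (rel2 sM sH)
           (\<lambda>(h1, h2, h3). tpure (rel2 sM sH) (act m0 h2, S h1 * m1 * h3)) (comult3 sH \<Delta>H h))
        (\<rho> m)"

end

theory Submission
  imports Defs
begin

text \<open>
  On paper the result is a short calculation in Sweedler notation.  Taking \<open>h = f(c)\<close> in the antipode
  law \<open>h\<^sub>1 S(h\<^sub>2) = \<epsilon>(h) 1\<close> and in its mirror image shows that \<open>S \<circ> f\<close> is the convolution inverse of \<open>f\<close>,
  because \<open>f\<close> commutes with comultiplication and counit.  Write
  \<open>\<rho>(c) = c\<^sub>2 \<otimes> S(f(c\<^sub>1)) f(c\<^sub>3)\<close>.  As \<open>S\<close> reverses comultiplication, both \<open>(\<rho> \<otimes> id) \<rho>\<close> and \<open>(id \<otimes> \<Delta>) \<rho>\<close>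
  send \<open>c\<close> to \<open>c\<^sub>3 \<otimes> S(f(c\<^sub>2)) f(c\<^sub>4) \<otimes> S(f(c\<^sub>1)) f(c\<^sub>5)\<close>, and \<open>\<epsilon> \<circ> S = \<epsilon>\<close> gives the counit law.  As \<open>S\<close>
  reverses products and \<open>f\<close> is \<open>H\<close>-linear,
  \<open>\<rho>(c h) = c\<^sub>2 h\<^sub>2 \<otimes> S(f(c\<^sub>1) h\<^sub>1) f(c\<^sub>3) h\<^sub>3 = c\<^sub>2 h\<^sub>2 \<otimes> S(h\<^sub>1) S(f(c\<^sub>1)) f(c\<^sub>3) h\<^sub>3\<close>,
  which is the Yetter-Drinfeld condition.  The two reversal properties of the antipode are
  \<open>antipode_mult\<close> and \<open>sw2_comult_antipode\<close>.

  Tensors are cosets of formal sums, so the work lies in making such calculations legitimate.  Over a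
  field the multilinear forms with values in the ground field separate the points of a tensor
  product (\<open>mem_tensor_iff\<close>), because every vector outside a subspace is detected by a linear form
  vanishing on the subspace.  A tensor \<open>T\<close> may therefore be replaced by the functional
  \<open>\<phi> \<mapsto> \<Sum> \<phi>(t\<^sub>1, t\<^sub>2)\<close> on bilinear forms, written \<open>sw2 T \<phi>\<close>, and likewise \<open>sw3 T \<phi>\<close> for three factors.
  In these terms a Sweedler sum with values in a tensor product becomes a nested scalar sum
  (\<open>ev_ttsum\<close>), the Hopf algebra axioms become rewrite rules for nested expressions \<open>sw2\<close>, and
  the only side conditions are multilinearity statements, which follow by rewriting.
\<close>

section \<open>Linear forms and formal sums\<close>

definition linear_form :: "('k::field \<Rightarrow> 'v \<Rightarrow> 'v::ab_group_add) \<Rightarrow> ('v \<Rightarrow> 'k) \<Rightarrow> bool" where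
  "linear_form s \<phi> \<longleftrightarrow> (\<forall>x y. \<phi> (x + y) = \<phi> x + \<phi> y) \<and> (\<forall>a x. \<phi> (s a x) = a * \<phi> x)"

lemma vector_space_mult: "vector_space ((*) :: 'k::field \<Rightarrow> 'k \<Rightarrow> 'k)"
  by unfold_locales (auto simp: algebra_simps)

lemma linear_iff_linear_form:
  "Vector_Spaces.linear s (*) \<phi> \<longleftrightarrow> vector_space s \<and> linear_form s \<phi>"
  for s :: "'k::field \<Rightarrow> 'v \<Rightarrow> 'v::ab_group_add"
  using Vector_Spaces.linear_iff[of s "(*)" \<phi>] vector_space_mult linear_form_def[of s \<phi>] by blast

lemma linear_form_0: "linear_form s \<phi> \<Longrightarrow> \<phi> 0 = 0"
  unfolding linear_form_def by (metis add_cancel_right_right)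

lemma linear_form_diff: "linear_form s \<phi> \<Longrightarrow> \<phi> (x - y) = \<phi> x - \<phi> y"
  unfolding linear_form_def by (metis add_diff_cancel diff_add_cancel)

lemma linear_form_sum: "linear_form s \<phi> \<Longrightarrow> \<phi> (sum g A) = (\<Sum>i\<in>A. \<phi> (g i))"
  by (induction A rule: infinite_finite_induct) (auto simp: linear_form_0 linear_form_def)

text \<open>
  A maximal independent subset \<open>B\<close> of \<open>G\<close> stays independent after adding \<open>x\<close>, so one may prescribe the
  value \<open>0\<close> on \<open>B\<close> and \<open>1\<close> at \<open>x\<close>.
\<close>

lemma linear_form_separates_span:
  assumes "vector_space s" and "x \<notin> module.span s G"
  obtains \<phi> where "linear_form s \<phi>" and "\<And>y. y \<in> module.span s G \<Longrightarrow> \<phi> y = 0" and "\<phi> x \<noteq> 0"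
proof -
  interpret vector_space_pair s "(*)"
    using assms(1) by (simp add: vector_space_pair_def vector_space_mult)
  obtain B where B: "B \<subseteq> G" "vs1.independent B" "G \<subseteq> vs1.span B"
    using vs1.maximal_independent_subset .
  have span: "vs1.span B = vs1.span G"
    using B by (metis vs1.span_mono vs1.span_span subset_antisym)
  with assms(2) have x: "x \<notin> vs1.span B" by simp
  then have "x \<notin> B" using vs1.span_base by blast
  from linear_independent_extend[OF vs1.independent_insertI[OF x B(2)], of "\<lambda>b. if b = x then 1 else 0"]
  obtain \<phi> where \<phi>: "Vector_Spaces.linear s (*) \<phi>" "\<forall>b\<in>insert x B. \<phi> b = (if b = x then 1 else 0)"
    by blast
  show thesis
  proof
    show "linear_form s \<phi>" using \<phi>(1) by (simp add: linear_iff_linear_form)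
    show "\<phi> y = 0" if "y \<in> vs1.span G" for y
      using \<phi>(2) \<open>x \<notin> B\<close> that span by (intro linear_eq_0_on_span[OF \<phi>(1), of B y]) auto
    show "\<phi> x \<noteq> 0" using \<phi>(2) by simp
  qed
qed

lemma eq_if_linear_forms_eq:
  assumes "vector_space s" and "\<And>\<phi>. linear_form s \<phi> \<Longrightarrow> \<phi> x = \<phi> y"
  shows "x = y"
proof (rule ccontr)
  interpret vector_space s by fact
  assume "x \<noteq> y"
  then have "x - y \<notin> span {}" by simp
  then obtain \<phi> where "linear_form s \<phi>" "\<phi> (x - y) \<noteq> 0"
    using linear_form_separates_span[OF assms(1)] by metis
  then show False using assms(2) linear_form_diff by fastforce
qed

lemma lookup_fscale [simp]: "Poly_Mapping.lookup (fscale a x) p = a * Poly_Mapping.lookup x p"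
  unfolding fscale_def by (simp add: Poly_Mapping.map.rep_eq when_def)

lemma vector_space_fscale: "vector_space (fscale :: 'k::field \<Rightarrow> ('a \<Rightarrow>\<^sub>0 'k) \<Rightarrow> _)"
  by unfold_locales (auto intro!: poly_mapping_eqI simp: lookup_add algebra_simps)

interpretation fs: vector_space fscale
  by (rule vector_space_fscale)

lemma lin_ext_superset:
  assumes "vector_space s" and "finite A" and "Poly_Mapping.keys x \<subseteq> A"
  shows "lin_ext s \<phi> x = (\<Sum>p\<in>A. s (Poly_Mapping.lookup x p) (\<phi> p))"
proof -
  interpret vector_space s by fact
  show ?thesis
    unfolding lin_ext_def using assms(2,3)
    by (intro sum.mono_neutral_left) (auto simp: in_keys_iff)
qed

lemma linear_lin_ext:
  assumes "vector_space s"
  shows "lin_ext s \<phi> (x + y) = lin_ext s \<phi> x + lin_ext s \<phi> y"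
    and "lin_ext s \<phi> (fscale a x) = s a (lin_ext s \<phi> x)"
    and "lin_ext s \<phi> (Poly_Mapping.single p a) = s a (\<phi> p)"
proof -
  interpret vector_space s by fact
  let ?A = "Poly_Mapping.keys x \<union> Poly_Mapping.keys y"
  have "Poly_Mapping.keys (x + y) \<subseteq> ?A" by (rule keys_add)
  then show "lin_ext s \<phi> (x + y) = lin_ext s \<phi> x + lin_ext s \<phi> y"
    by (simp add: lin_ext_superset[OF assms, of ?A] lookup_add scale_left_distrib sum.distrib)
  have "Poly_Mapping.keys (fscale a x) \<subseteq> Poly_Mapping.keys x" by (auto simp: in_keys_iff)
  then show "lin_ext s \<phi> (fscale a x) = s a (lin_ext s \<phi> x)"
    by (simp add: lin_ext_superset[OF assms, of "Poly_Mapping.keys x"] scale_sum_right)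
  show "lin_ext s \<phi> (Poly_Mapping.single p a) = s a (\<phi> p)"
    by (simp add: lin_ext_superset[OF assms, of "{p}"])
qed

lemmas lin_ext_field = linear_lin_ext[OF vector_space_mult]

lemma linear_form_lin_ext: "linear_form fscale (lin_ext (*) \<phi>)"
  by (simp add: linear_form_def lin_ext_field)

text \<open>
  This reduces sums with values in any vector space to sums in the ground field.
\<close>

lemma linear_form_of_lin_ext:
  assumes "linear_form s L"
  shows "L (lin_ext s \<phi> x) = lin_ext (*) (\<lambda>p. L (\<phi> p)) x"
  using assms unfolding lin_ext_def
  by (simp add: linear_form_sum[OF assms]) (simp add: linear_form_def)

text \<open>
  The tuples form a basis of the space of formal sums, so its linear forms are exactly the linear
  extensions of functions on tuples.
\<close>

lemma linear_form_fscale_eq_lin_ext: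
  fixes L :: "('a \<Rightarrow>\<^sub>0 'k::field) \<Rightarrow> 'k"
  assumes "linear_form fscale L"
  shows "L = lin_ext (*) (\<lambda>p. L (Poly_Mapping.single p 1))"
proof
  fix x :: "'a \<Rightarrow>\<^sub>0 'k"
  have "lin_ext fscale (\<lambda>p. Poly_Mapping.single p 1) x = x"
  proof (rule poly_mapping_eqI)
    fix q
    have "Poly_Mapping.lookup (lin_ext fscale (\<lambda>p. Poly_Mapping.single p (1::'k)) x) q
        = (\<Sum>p\<in>Poly_Mapping.keys x. if p = q then Poly_Mapping.lookup x p else 0)"
      by (auto simp: lin_ext_def lookup_sum lookup_single when_def if_distrib cong: if_cong)
    also have "\<dots> = Poly_Mapping.lookup x q" by (simp add: in_keys_iff)
    finally show "Poly_Mapping.lookup (lin_ext fscale (\<lambda>p. Poly_Mapping.single p (1::'k)) x) q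
        = Poly_Mapping.lookup x q" .
  qed
  then show "L x = lin_ext (*) (\<lambda>p. L (Poly_Mapping.single p 1)) x"
    using linear_form_of_lin_ext[OF assms] by metis
qed


section \<open>Tensors as functionals on multilinear forms\<close>

text \<open>
  A function on tuples satisfies this condition precisely when its linear extension induces a linear
  form on the quotient by \<open>R\<close>; for tensor relations these are the multilinear forms
  (\<open>descends_rel2\<close>, \<open>descends_rel3\<close>).
\<close>

definition descends :: "('a \<Rightarrow>\<^sub>0 'k::field) set \<Rightarrow> ('a \<Rightarrow> 'k) \<Rightarrow> bool" where
  "descends R \<phi> \<longleftrightarrow> (\<forall>x\<in>R. lin_ext (*) \<phi> x = 0)"

definition tensor :: "('a \<Rightarrow>\<^sub>0 'k::field) set \<Rightarrow> ('a \<Rightarrow>\<^sub>0 'k) set \<Rightarrow> bool" where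
  "tensor R T \<longleftrightarrow> T \<in> range (tclass R)"

text \<open>
  For a tensor \<open>T\<close> and \<open>\<phi>\<close> that descends, the value does not depend on the representative
  (\<open>mem_tensor_iff\<close>).  Fixing one representative for all \<open>\<phi>\<close>, even those that do not
  descend, makes linearity in \<open>\<phi>\<close> and the interchange of two sums unconditional.
\<close>

definition ev :: "('a \<Rightarrow>\<^sub>0 'k::field) set \<Rightarrow> ('a \<Rightarrow> 'k) \<Rightarrow> 'k" where
  "ev T \<phi> = lin_ext (*) \<phi> (SOME x. x \<in> T)"

lemma ev_add: "ev T (\<lambda>p. \<phi> p + \<psi> p) = ev T \<phi> + ev T \<psi>"
  by (simp add: ev_def lin_ext_def algebra_simps sum.distrib)

lemma ev_scale: "ev T (\<lambda>p. a * \<phi> p) = a * ev T \<phi>"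
  by (simp add: ev_def lin_ext_def sum_distrib_left algebra_simps)

lemma ev_swap: "ev T (\<lambda>p. ev T' (\<lambda>q. \<phi> p q)) = ev T' (\<lambda>q. ev T (\<lambda>p. \<phi> p q))"
  unfolding ev_def lin_ext_def
  by (simp add: sum_distrib_left algebra_simps) (rule sum.swap)

lemma descends_span:
  "descends (module.span fscale G) \<phi> \<longleftrightarrow> (\<forall>x\<in>G. lin_ext (*) \<phi> x = 0)"
proof
  assume G: "\<forall>x\<in>G. lin_ext (*) \<phi> x = 0"
  interpret vector_space_pair fscale "(*)"
    by (simp add: vector_space_pair_def vector_space_fscale vector_space_mult)
  show "descends (module.span fscale G) \<phi>"
    unfolding descends_def
  proof
    have lin: "Vector_Spaces.linear fscale (*) (lin_ext (*) \<phi>)"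
      by (simp add: linear_iff_linear_form vector_space_fscale linear_form_lin_ext)
    show "lin_ext (*) \<phi> x = 0" if "x \<in> module.span fscale G" for x
      using linear_eq_0_on_span[OF lin _ that] G by blast
  qed
qed (auto simp: descends_def fs.span_base)

text \<open>
  By duality: a formal sum outside \<open>R\<close> is detected by a linear form that vanishes on \<open>R\<close>, and
  such a form is the linear extension of a function that descends.
\<close>

lemma mem_if_descends:
  assumes "fs.subspace R" and "\<And>\<phi>. descends R \<phi> \<Longrightarrow> lin_ext (*) \<phi> x = 0"
  shows "x \<in> R"
proof (rule ccontr)
  assume "x \<notin> R"
  then have "x \<notin> fs.span R" using assms(1) fs.span_eq_iff by metis
  then obtain L where L: "linear_form fscale L" "\<And>y. y \<in> fs.span R \<Longrightarrow> L y = 0" "L x \<noteq> 0"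
    using linear_form_separates_span[OF vector_space_fscale] by metis
  note eq = linear_form_fscale_eq_lin_ext[OF L(1)]
  have "descends R (\<lambda>p. L (Poly_Mapping.single p 1))"
    unfolding descends_def eq[symmetric] using L(2) fs.span_base by blast
  from assms(2)[OF this] L(3) show False unfolding eq[symmetric] by simp
qed

lemma mem_tclass_iff:
  assumes "fs.subspace R"
  shows "y \<in> tclass R x \<longleftrightarrow> (\<forall>\<phi>. descends R \<phi> \<longrightarrow> lin_ext (*) \<phi> y = lin_ext (*) \<phi> x)"
proof
  assume "y \<in> tclass R x"
  then show "\<forall>\<phi>. descends R \<phi> \<longrightarrow> lin_ext (*) \<phi> y = lin_ext (*) \<phi> x"
    by (auto simp: tclass_def descends_def linear_form_diff[OF linear_form_lin_ext])
next
  assume "\<forall>\<phi>. descends R \<phi> \<longrightarrow> lin_ext (*) \<phi> y = lin_ext (*) \<phi> x"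
  then have "y - x \<in> R"
    by (intro mem_if_descends[OF assms]) (simp add: linear_form_diff[OF linear_form_lin_ext])
  then show "y \<in> tclass R x" by (simp add: tclass_def)
qed

text \<open>
  On functions that descend, \<open>ev T\<close> is therefore independent of the representative, and equality of
  tensors can be tested on them.
\<close>

lemma mem_tensor_iff:
  assumes R: "fs.subspace R" and T: "tensor R T"
  shows "y \<in> T \<longleftrightarrow> (\<forall>\<phi>. descends R \<phi> \<longrightarrow> lin_ext (*) \<phi> y = ev T \<phi>)"
proof -
  from T obtain x where x: "T = tclass R x" by (auto simp: tensor_def)
  then have "x \<in> T" by (simp add: mem_tclass_iff[OF R])
  then have "(SOME x. x \<in> T) \<in> tclass R x" unfolding x by (rule someI)
  then show ?thesis unfolding ev_def x by (auto simp: mem_tclass_iff[OF R])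
qed

lemma tensor_nonempty: "fs.subspace R \<Longrightarrow> tensor R T \<Longrightarrow> \<exists>x. x \<in> T"
  unfolding tensor_def by (auto simp: mem_tclass_iff)

lemma tensor_eqI:
  assumes "fs.subspace R" "tensor R T" "tensor R T'"
    and "\<And>\<phi>. descends R \<phi> \<Longrightarrow> ev T \<phi> = ev T' \<phi>"
  shows "T = T'"
  using assms by (auto simp: mem_tensor_iff)

lemma tensor_tpure: "tensor R (tpure R p)"
  by (simp add: tensor_def tpure_def)

lemma ev_tpure:
  assumes "fs.subspace R" and "descends R \<phi>"
  shows "ev (tpure R p) \<phi> = \<phi> p"
proof -
  have "Poly_Mapping.single p 1 \<in> tpure R p"
    by (simp add: tpure_def mem_tclass_iff[OF assms(1)])
  then have "lin_ext (*) \<phi> (Poly_Mapping.single p 1) = ev (tpure R p) \<phi>"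
    using assms mem_tensor_iff[OF assms(1) tensor_tpure] by blast
  then show ?thesis by (simp add: lin_ext_field)
qed

text \<open>
  All formal sums obtained from different representatives of \<open>T\<close> and of the \<open>\<Phi> p\<close> take the same values
  on functions that descend, hence they lie in one coset.  The hypothesis \<open>comp\<close> is the
  multilinearity of \<open>\<Phi>\<close>, tested on scalars.
\<close>

lemma
  assumes R: "fs.subspace R" and R': "fs.subspace R'"
    and T: "tensor R' T" and \<Phi>: "\<And>p. tensor R (\<Phi> p)"
    and comp: "\<And>\<phi>. descends R \<phi> \<Longrightarrow> descends R' (\<lambda>p. ev (\<Phi> p) \<phi>)"
  shows tensor_ttsum: "tensor R (ttsum R \<Phi> T)"
    and ev_ttsum: "descends R \<phi> \<Longrightarrow> ev (ttsum R \<Phi> T) \<phi> = ev T (\<lambda>p. ev (\<Phi> p) \<phi>)"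
proof -
  have eval: "lin_ext (*) \<phi> (lin_ext fscale g x) = ev T (\<lambda>p. ev (\<Phi> p) \<phi>)"
    if "x \<in> T" "\<forall>p. g p \<in> \<Phi> p" "descends R \<phi>" for x g \<phi>
  proof -
    have "lin_ext (*) \<phi> (lin_ext fscale g x) = lin_ext (*) (\<lambda>p. lin_ext (*) \<phi> (g p)) x"
      by (rule linear_form_of_lin_ext[OF linear_form_lin_ext])
    also have "(\<lambda>p. lin_ext (*) \<phi> (g p)) = (\<lambda>p. ev (\<Phi> p) \<phi>)"
      using that mem_tensor_iff[OF R \<Phi>] by (intro ext) blast
    finally show ?thesis using that mem_tensor_iff[OF R' T] comp by metis
  qed
  obtain x where x: "x \<in> T" using tensor_nonempty[OF R' T] by blast
  obtain g where g: "\<forall>p. g p \<in> \<Phi> p" using tensor_nonempty[OF R \<Phi>] by metis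
  have "tclass R (lin_ext fscale h y) = tclass R (lin_ext fscale g x)"
    if "y \<in> T" "\<forall>p. h p \<in> \<Phi> p" for y h
    by (intro set_eqI) (simp add: mem_tclass_iff[OF R] eval[OF that] eval[OF x g])
  then have eq: "ttsum R \<Phi> T = tclass R (lin_ext fscale g x)"
    unfolding ttsum_def using x g by blast
  then show ten: "tensor R (ttsum R \<Phi> T)" by (simp add: tensor_def)
  assume \<phi>: "descends R \<phi>"
  have "lin_ext fscale g x \<in> ttsum R \<Phi> T" unfolding eq by (simp add: mem_tclass_iff[OF R])
  then show "ev (ttsum R \<Phi> T) \<phi> = ev T (\<lambda>p. ev (\<Phi> p) \<phi>)"
    using \<phi> eval[OF x g] mem_tensor_iff[OF R ten] by metis
qed

lemma linear_to_tensor_iff: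
  assumes R: "fs.subspace R"
  shows "linear_to_tensor s R D \<longleftrightarrow>
    (\<forall>v. tensor R (D v)) \<and> (\<forall>\<phi>. descends R \<phi> \<longrightarrow> linear_form s (\<lambda>v. ev (D v) \<phi>))"
proof (cases "\<forall>v. tensor R (D v)")
  case False
  then show ?thesis by (auto simp: linear_to_tensor_def tensor_def)
next
  case True
  note mem = mem_tensor_iff[OF R True[rule_format]]
  note val = mem[THEN iffD1, rule_format]
  have sum: "(\<forall>x\<in>D u. \<forall>y\<in>D v. x + y \<in> D (u + v)) \<longleftrightarrow>
      (\<forall>\<phi>. descends R \<phi> \<longrightarrow> ev (D (u + v)) \<phi> = ev (D u) \<phi> + ev (D v) \<phi>)" for u v
  proof -
    obtain x y where "x \<in> D u" "y \<in> D v" using tensor_nonempty[OF R True[rule_format]] by metis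
    moreover have "(\<forall>x\<in>D u. \<forall>y\<in>D v. x + y \<in> D (u + v)) \<longleftrightarrow> (\<forall>x\<in>D u. \<forall>y\<in>D v.
        \<forall>\<phi>. descends R \<phi> \<longrightarrow> ev (D (u + v)) \<phi> = ev (D u) \<phi> + ev (D v) \<phi>)"
      by (intro ball_cong refl) (auto simp: mem[of _ "u + v"] lin_ext_field val)
    ultimately show ?thesis by blast
  qed
  have scale: "(\<forall>x\<in>D v. fscale a x \<in> D (s a v)) \<longleftrightarrow>
      (\<forall>\<phi>. descends R \<phi> \<longrightarrow> ev (D (s a v)) \<phi> = a * ev (D v) \<phi>)" for a v
  proof -
    obtain x where "x \<in> D v" using tensor_nonempty[OF R True[rule_format]] by metis
    moreover have "(\<forall>x\<in>D v. fscale a x \<in> D (s a v)) \<longleftrightarrow> (\<forall>x\<in>D v.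
        \<forall>\<phi>. descends R \<phi> \<longrightarrow> ev (D (s a v)) \<phi> = a * ev (D v) \<phi>)"
      by (intro ball_cong refl) (auto simp: mem[of _ "s a v"] lin_ext_field val)
    ultimately show ?thesis by blast
  qed
  show ?thesis
    using True unfolding linear_to_tensor_def sum scale linear_form_def tensor_def by blast
qed

text \<open>
  Linear forms also separate the vectors of the target space.  Hence multilinearity of \<open>\<phi>\<close>, which
  makes \<open>tsum\<close> independent of the representative, needs to be tested only after composing with a linear form.
\<close>

lemma linear_form_tsum:
  assumes R: "fs.subspace R" and T: "tensor R T" and s: "vector_space s"
    and comp: "\<And>L. linear_form s L \<Longrightarrow> descends R (\<lambda>p. L (\<phi> p))"
    and L: "linear_form s L"
  shows "L (tsum s \<phi> T) = ev T (\<lambda>p. L (\<phi> p))"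
proof -
  have L_eval: "L (lin_ext s \<phi> x) = ev T (\<lambda>p. L (\<phi> p))" if "x \<in> T" "linear_form s L" for x L
    using that comp mem_tensor_iff[OF R T] by (metis linear_form_of_lin_ext)
  obtain x where x: "x \<in> T" using tensor_nonempty[OF R T] by blast
  have "lin_ext s \<phi> y = lin_ext s \<phi> x" if "y \<in> T" for y
    using that x by (intro eq_if_linear_forms_eq[OF s]) (simp add: L_eval)
  then have "lin_ext s \<phi> ` T = {lin_ext s \<phi> x}" using x by blast
  then show ?thesis by (simp add: tsum_def L_eval[OF x L])
qed


section \<open>Sweedler sums\<close>

definition bilinear_form ::
  "('k::field \<Rightarrow> 'v \<Rightarrow> 'v::ab_group_add) \<Rightarrow> ('k \<Rightarrow> 'w \<Rightarrow> 'w::ab_group_add)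
   \<Rightarrow> ('v \<Rightarrow> 'w \<Rightarrow> 'k) \<Rightarrow> bool" where
  "bilinear_form sV sW \<phi> \<longleftrightarrow>
     (\<forall>w. linear_form sV (\<lambda>v. \<phi> v w)) \<and> (\<forall>v. linear_form sW (\<lambda>w. \<phi> v w))"

definition trilinear_form ::
  "('k::field \<Rightarrow> 'u \<Rightarrow> 'u::ab_group_add) \<Rightarrow> ('k \<Rightarrow> 'v \<Rightarrow> 'v::ab_group_add)
   \<Rightarrow> ('k \<Rightarrow> 'w \<Rightarrow> 'w::ab_group_add) \<Rightarrow> ('u \<Rightarrow> 'v \<Rightarrow> 'w \<Rightarrow> 'k) \<Rightarrow> bool" where
  "trilinear_form sU sV sW \<phi> \<longleftrightarrow>
     (\<forall>v w. linear_form sU (\<lambda>u. \<phi> u v w)) \<and> (\<forall>u w. linear_form sV (\<lambda>v. \<phi> u v w))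
   \<and> (\<forall>u v. linear_form sW (\<lambda>w. \<phi> u v w))"

text \<open>
  Additivity in an argument other than the last is stated as an equation between functions.
  The rewrite rules then also apply to partial applications such as \<open>\<phi> (x + y)\<close>, which arise from
  \<open>\<lambda>w. \<phi> (x + y) w\<close> by eta-contraction inside nested sums.
\<close>

lemma bilinear_form_unfold:
  "bilinear_form sV sW \<phi> \<longleftrightarrow>
     (\<forall>x y. \<phi> (x + y) = (\<lambda>w. \<phi> x w + \<phi> y w)) \<and> (\<forall>a x. \<phi> (sV a x) = (\<lambda>w. a * \<phi> x w))
   \<and> (\<forall>v x y. \<phi> v (x + y) = \<phi> v x + \<phi> v y) \<and> (\<forall>v a x. \<phi> v (sW a x) = a * \<phi> v x)"
  by (auto simp: bilinear_form_def linear_form_def fun_eq_iff)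

lemma trilinear_form_unfold:
  "trilinear_form sU sV sW \<phi> \<longleftrightarrow>
     (\<forall>x y. \<phi> (x + y) = (\<lambda>v w. \<phi> x v w + \<phi> y v w)) \<and> (\<forall>a x. \<phi> (sU a x) = (\<lambda>v w. a * \<phi> x v w))
   \<and> (\<forall>u x y. \<phi> u (x + y) = (\<lambda>w. \<phi> u x w + \<phi> u y w)) \<and> (\<forall>u a x. \<phi> u (sV a x) = (\<lambda>w. a * \<phi> u x w))
   \<and> (\<forall>u v x y. \<phi> u v (x + y) = \<phi> u v x + \<phi> u v y) \<and> (\<forall>u v a x. \<phi> u v (sW a x) = a * \<phi> u v x)"
  by (auto simp: trilinear_form_def linear_form_def fun_eq_iff)

lemma lin_ext_slot_relations:
  "(\<forall>x\<in>slot_relations s K. lin_ext (*) \<phi> x = 0) \<longleftrightarrow> linear_form s (\<lambda>v. \<phi> (K v))"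
proof -
  have "(\<forall>x\<in>slot_relations s K. P x) \<longleftrightarrow>
      (\<forall>u v. P (Poly_Mapping.single (K (u + v)) 1 - Poly_Mapping.single (K u) 1 - Poly_Mapping.single (K v) 1))
    \<and> (\<forall>a v. P (Poly_Mapping.single (K (s a v)) 1 - fscale a (Poly_Mapping.single (K v) 1)))" for P
    unfolding slot_relations_def by blast
  then show ?thesis
    by (simp add: linear_form_def linear_form_diff[OF linear_form_lin_ext] lin_ext_field diff_diff_eq)
qed

lemma descends_rel2:
  "descends (rel2 sV sW) \<phi> \<longleftrightarrow> bilinear_form sV sW (\<lambda>v w. \<phi> (v, w))"
  by (simp add: rel2_def descends_span bilinear_form_def lin_ext_slot_relations ball_Un)

lemma descends_rel3:
  "descends (rel3 sU sV sW) \<phi> \<longleftrightarrow> trilinear_form sU sV sW (\<lambda>u v w. \<phi> (u, v, w))"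
  by (simp add: rel3_def descends_span trilinear_form_def lin_ext_slot_relations ball_Un)

lemma subspace_rel2: "fs.subspace (rel2 sV sW)"
  by (simp add: rel2_def)

lemma subspace_rel3: "fs.subspace (rel3 sU sV sW)"
  by (simp add: rel3_def)

definition sw2 :: "(('v \<times> 'w) \<Rightarrow>\<^sub>0 'k::field) set \<Rightarrow> ('v \<Rightarrow> 'w \<Rightarrow> 'k) \<Rightarrow> 'k" where
  "sw2 T \<phi> = ev T (\<lambda>(v, w). \<phi> v w)"

definition sw3 :: "(('u \<times> 'v \<times> 'w) \<Rightarrow>\<^sub>0 'k::field) set \<Rightarrow> ('u \<Rightarrow> 'v \<Rightarrow> 'w \<Rightarrow> 'k) \<Rightarrow> 'k" where
  "sw3 T \<phi> = ev T (\<lambda>(u, v, w). \<phi> u v w)"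

lemma ev_eq_sw2: "ev T \<phi> = sw2 T (\<lambda>v w. \<phi> (v, w))"
  by (simp add: sw2_def)

lemma ev_eq_sw3: "ev T \<phi> = sw3 T (\<lambda>u v w. \<phi> (u, v, w))"
  by (simp add: sw3_def)

lemma sw2_add: "sw2 T (\<lambda>x y. \<phi> x y + \<psi> x y) = sw2 T \<phi> + sw2 T \<psi>"
  unfolding sw2_def ev_add[symmetric] by (simp add: case_prod_unfold)

lemma sw2_scale: "sw2 T (\<lambda>x y. a * \<phi> x y) = a * sw2 T \<phi>"
  unfolding sw2_def ev_scale[symmetric] by (simp add: case_prod_unfold)

lemma sw3_add: "sw3 T (\<lambda>x y z. \<phi> x y z + \<psi> x y z) = sw3 T \<phi> + sw3 T \<psi>"
  unfolding sw3_def ev_add[symmetric] by (simp add: case_prod_unfold)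

lemma sw3_scale: "sw3 T (\<lambda>x y z. a * \<phi> x y z) = a * sw3 T \<phi>"
  unfolding sw3_def ev_scale[symmetric] by (simp add: case_prod_unfold)

lemma sw2_swap:
  "sw2 T (\<lambda>x y. sw2 T' (\<lambda>u v. \<phi> x y u v)) = sw2 T' (\<lambda>u v. sw2 T (\<lambda>x y. \<phi> x y u v))"
  unfolding sw2_def using ev_swap[of T T' "\<lambda>p q. \<phi> (fst p) (snd p) (fst q) (snd q)"]
  by (simp add: case_prod_unfold)

lemmas sw_linear = sw2_add sw2_scale sw3_add sw3_scale

lemma tensor2_eqI:
  assumes "tensor (rel2 sV sW) T" "tensor (rel2 sV sW) T'"
    and "\<And>\<phi>. bilinear_form sV sW \<phi> \<Longrightarrow> sw2 T \<phi> = sw2 T' \<phi>"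
  shows "T = T'"
  using assms by (intro tensor_eqI[OF subspace_rel2]) (auto simp: descends_rel2 ev_eq_sw2)

lemma tensor3_eqI:
  assumes "tensor (rel3 sU sV sW) T" "tensor (rel3 sU sV sW) T'"
    and "\<And>\<phi>. trilinear_form sU sV sW \<phi> \<Longrightarrow> sw3 T \<phi> = sw3 T' \<phi>"
  shows "T = T'"
  using assms by (intro tensor_eqI[OF subspace_rel3]) (auto simp: descends_rel3 ev_eq_sw3)

lemma sw2_tpure: "bilinear_form sV sW \<phi> \<Longrightarrow> sw2 (tpure (rel2 sV sW) (v, w)) \<phi> = \<phi> v w"
  unfolding sw2_def by (subst ev_tpure[OF subspace_rel2]) (auto simp: descends_rel2)

lemma sw3_tpure:
  "trilinear_form sU sV sW \<phi> \<Longrightarrow> sw3 (tpure (rel3 sU sV sW) (u, v, w)) \<phi> = \<phi> u v w"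
  unfolding sw3_def by (subst ev_tpure[OF subspace_rel3]) (auto simp: descends_rel3)

text \<open>
  Substitution of one Sweedler sum into another.  The functional \<open>F\<close> records what each \<open>\<Phi> x y\<close>
  does to a form, so that nested sums are evaluated from the inside outwards and only the
  multilinearity of \<open>F \<phi>\<close> is left to prove.  The three variants differ in the number of tensor factors of
  source and target.
\<close>

lemma sw2_ttsum_2:
  assumes "tensor (rel2 sA sB) T" and "\<And>x y. tensor (rel2 sV sW) (\<Phi> x y)"
    and "\<And>x y \<phi>. bilinear_form sV sW \<phi> \<Longrightarrow> sw2 (\<Phi> x y) \<phi> = F \<phi> x y"
    and "\<And>\<phi>. bilinear_form sV sW \<phi> \<Longrightarrow> bilinear_form sA sB (F \<phi>)"
  shows "tensor (rel2 sV sW) (ttsum (rel2 sV sW) (\<lambda>(x, y). \<Phi> x y) T)"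
    and "bilinear_form sV sW \<phi> \<Longrightarrow>
      sw2 (ttsum (rel2 sV sW) (\<lambda>(x, y). \<Phi> x y) T) \<phi> = sw2 T (F \<phi>)"
  using tensor_ttsum[OF subspace_rel2 subspace_rel2 assms(1), of sV sW "\<lambda>(x, y). \<Phi> x y"]
    ev_ttsum[OF subspace_rel2 subspace_rel2 assms(1), of sV sW "\<lambda>(x, y). \<Phi> x y"
      "\<lambda>(v, w). \<phi> v w"] assms(2-4)
  by (auto simp: descends_rel2 descends_rel3 ev_eq_sw2)

lemma sw3_ttsum_2:
  assumes "tensor (rel2 sA sB) T" and "\<And>x y. tensor (rel3 sU sV sW) (\<Phi> x y)"
    and "\<And>x y \<phi>. trilinear_form sU sV sW \<phi> \<Longrightarrow> sw3 (\<Phi> x y) \<phi> = F \<phi> x y"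
    and "\<And>\<phi>. trilinear_form sU sV sW \<phi> \<Longrightarrow> bilinear_form sA sB (F \<phi>)"
  shows "tensor (rel3 sU sV sW) (ttsum (rel3 sU sV sW) (\<lambda>(x, y). \<Phi> x y) T)"
    and "trilinear_form sU sV sW \<phi> \<Longrightarrow>
      sw3 (ttsum (rel3 sU sV sW) (\<lambda>(x, y). \<Phi> x y) T) \<phi> = sw2 T (F \<phi>)"
  using tensor_ttsum[OF subspace_rel3 subspace_rel2 assms(1), of sU sV sW "\<lambda>(x, y). \<Phi> x y"]
    ev_ttsum[OF subspace_rel3 subspace_rel2 assms(1), of sU sV sW "\<lambda>(x, y). \<Phi> x y"
      "\<lambda>(u, v, w). \<phi> u v w"] assms(2-4)
  by (auto simp: descends_rel2 descends_rel3 ev_eq_sw2[of T]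
      ev_eq_sw3[of "\<Phi> x y" for x y] ev_eq_sw3[of "ttsum R \<Psi> T" for R \<Psi>])

lemma sw2_ttsum_3:
  assumes "tensor (rel3 sA sB sC) T" and "\<And>x y z. tensor (rel2 sV sW) (\<Phi> x y z)"
    and "\<And>x y z \<phi>. bilinear_form sV sW \<phi> \<Longrightarrow> sw2 (\<Phi> x y z) \<phi> = F \<phi> x y z"
    and "\<And>\<phi>. bilinear_form sV sW \<phi> \<Longrightarrow> trilinear_form sA sB sC (F \<phi>)"
  shows "tensor (rel2 sV sW) (ttsum (rel2 sV sW) (\<lambda>(x, y, z). \<Phi> x y z) T)"
    and "bilinear_form sV sW \<phi> \<Longrightarrow>
      sw2 (ttsum (rel2 sV sW) (\<lambda>(x, y, z). \<Phi> x y z) T) \<phi> = sw3 T (F \<phi>)"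
  using tensor_ttsum[OF subspace_rel2 subspace_rel3 assms(1), of sV sW "\<lambda>(x, y, z). \<Phi> x y z"]
    ev_ttsum[OF subspace_rel2 subspace_rel3 assms(1), of sV sW "\<lambda>(x, y, z). \<Phi> x y z"
      "\<lambda>(v, w). \<phi> v w"] assms(2-4)
  by (auto simp: descends_rel2 descends_rel3 ev_eq_sw3[of T]
      ev_eq_sw2[of "\<Phi> x y z" for x y z] ev_eq_sw2[of "ttsum R \<Psi> T" for R \<Psi>])

lemma sw2_linear_to_tensor:
  "linear_to_tensor s (rel2 sV sW) D \<longleftrightarrow>
    (\<forall>v. tensor (rel2 sV sW) (D v)) \<and>
    (\<forall>\<phi>. bilinear_form sV sW \<phi> \<longrightarrow> linear_form s (\<lambda>v. sw2 (D v) \<phi>))"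
proof -
  have "(\<forall>\<phi>. bilinear_form sV sW (\<lambda>v w. \<phi> (v, w)) \<longrightarrow> linear_form s (\<lambda>v. sw2 (D v) (\<lambda>v w. \<phi> (v, w))))
    \<longleftrightarrow> (\<forall>\<phi>. bilinear_form sV sW \<phi> \<longrightarrow> linear_form s (\<lambda>v. sw2 (D v) \<phi>))" (is "?L \<longleftrightarrow> ?R")
  proof
    assume ?L
    then show ?R by (intro allI) (drule spec[where x = "\<lambda>(x, y). _ x y"], simp)
  qed simp
  then show ?thesis
    unfolding linear_to_tensor_iff[OF subspace_rel2] descends_rel2 ev_eq_sw2 by simp
qed

lemma linear_form_tsum2:
  assumes "tensor (rel2 sV sW) T" and "vector_space s" and "linear_form s L"
    and "\<And>L. linear_form s L \<Longrightarrow> bilinear_form sV sW (\<lambda>x y. L (\<phi> x y))"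
  shows "L (tsum s (\<lambda>(x, y). \<phi> x y) T) = sw2 T (\<lambda>x y. L (\<phi> x y))"
  using linear_form_tsum[OF subspace_rel2 assms(1,2) _ assms(3), of "\<lambda>(x, y). \<phi> x y"] assms(4)
  by (auto simp: descends_rel2 ev_eq_sw2)

section \<open>Coalgebras\<close>

text \<open>
  Rules that push sums and scalars out of every linear operation; rewriting with them proves the
  multilinearity side conditions of the Sweedler calculations below.
\<close>

named_theorems multilinear

lemmas [multilinear] = linear_form_def bilinear_form_unfold trilinear_form_unfold sw_linear distrib_left distrib_right

context k_coalgebra
begin

lemma tensor_comult: "tensor (rel2 s s) (\<Delta> c)"
  and linear_form_sw2_comult: "bilinear_form s s \<phi> \<Longrightarrow> linear_form s (\<lambda>c. sw2 (\<Delta> c) \<phi>)"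
  using comult_linear unfolding sw2_linear_to_tensor by auto

lemma sw2_comult_linear [multilinear]:
  assumes "bilinear_form s s \<phi>"
  shows "sw2 (\<Delta> (c + d)) \<phi> = sw2 (\<Delta> c) \<phi> + sw2 (\<Delta> d) \<phi>"
    and "sw2 (\<Delta> (s a c)) \<phi> = a * sw2 (\<Delta> c) \<phi>"
  using linear_form_sw2_comult[OF assms] by (auto simp: linear_form_def)

lemma counit_linear_form [multilinear]: "\<epsilon> (c + d) = \<epsilon> c + \<epsilon> d" "\<epsilon> (s a c) = a * \<epsilon> c"
  using counit_linear by (auto simp: linear_iff_linear_form linear_form_def)

lemma tensor_comult_left:
  "tensor (rel3 s s s) (ttsum (rel3 s s s) (\<lambda>(x1, x2). tpure (rel3 s s s) (x1, x2, y)) (\<Delta> x))"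
  and sw3_comult_left: "trilinear_form s s s \<phi> \<Longrightarrow>
    sw3 (ttsum (rel3 s s s) (\<lambda>(x1, x2). tpure (rel3 s s s) (x1, x2, y)) (\<Delta> x)) \<phi>
    = sw2 (\<Delta> x) (\<lambda>x1 x2. \<phi> x1 x2 y)"
  by (rule sw3_ttsum_2[OF tensor_comult tensor_tpure sw3_tpure]; simp add: multilinear)+

lemma tensor_comult_right:
  "tensor (rel3 s s s) (ttsum (rel3 s s s) (\<lambda>(y1, y2). tpure (rel3 s s s) (x, y1, y2)) (\<Delta> y))"
  and sw3_comult_right: "trilinear_form s s s \<phi> \<Longrightarrow>
    sw3 (ttsum (rel3 s s s) (\<lambda>(y1, y2). tpure (rel3 s s s) (x, y1, y2)) (\<Delta> y)) \<phi>
    = sw2 (\<Delta> y) (\<lambda>y1 y2. \<phi> x y1 y2)"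
  by (rule sw3_ttsum_2[OF tensor_comult tensor_tpure sw3_tpure]; simp add: multilinear)+

lemma tensor_comult3: "tensor (rel3 s s s) (comult3 s \<Delta> c)"
  and sw3_comult3: "trilinear_form s s s \<phi> \<Longrightarrow>
    sw3 (comult3 s \<Delta> c) \<phi> = sw2 (\<Delta> c) (\<lambda>x y. sw2 (\<Delta> x) (\<lambda>x1 x2. \<phi> x1 x2 y))"
  unfolding comult3_def
  by (rule sw3_ttsum_2[OF tensor_comult tensor_comult_left sw3_comult_left]; simp add: multilinear)+

lemma sw3_comult3_right:
  "trilinear_form s s s \<phi> \<Longrightarrow>
    sw3 (comult3 s \<Delta> c) \<phi> = sw2 (\<Delta> c) (\<lambda>x y. sw2 (\<Delta> y) (\<lambda>y1 y2. \<phi> x y1 y2))"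
  unfolding coassoc
  by (rule sw3_ttsum_2[OF tensor_comult tensor_comult_right sw3_comult_right]; simp add: multilinear)+

lemma sw2_coassoc:
  "trilinear_form s s s \<phi> \<Longrightarrow>
    sw2 (\<Delta> c) (\<lambda>x y. sw2 (\<Delta> x) (\<lambda>x1 x2. \<phi> x1 x2 y))
    = sw2 (\<Delta> c) (\<lambda>x y. sw2 (\<Delta> y) (\<lambda>y1 y2. \<phi> x y1 y2))"
  using sw3_comult3 sw3_comult3_right by metis

lemma sw2_counit_left:
  assumes "linear_form s L"
  shows "sw2 (\<Delta> c) (\<lambda>x y. \<epsilon> x * L y) = L c"
proof -
  have "L (tsum s (\<lambda>(x, y). s (\<epsilon> x) y) (\<Delta> c)) = sw2 (\<Delta> c) (\<lambda>x y. L (s (\<epsilon> x) y))"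
    by (rule linear_form_tsum2[OF tensor_comult _ assms])
       (simp_all add: vector_space_axioms multilinear algebra_simps)
  with assms show ?thesis by (simp add: counit_left linear_form_def)
qed

lemma sw2_counit_right:
  assumes "linear_form s L"
  shows "sw2 (\<Delta> c) (\<lambda>x y. \<epsilon> y * L x) = L c"
proof -
  have "L (tsum s (\<lambda>(x, y). s (\<epsilon> y) x) (\<Delta> c)) = sw2 (\<Delta> c) (\<lambda>x y. L (s (\<epsilon> y) x))"
    by (rule linear_form_tsum2[OF tensor_comult _ assms])
       (simp_all add: vector_space_axioms multilinear algebra_simps)
  with assms show ?thesis by (simp add: counit_right linear_form_def)
qed

end

section \<open>The antipode\<close>

context hopf_algebra
begin

lemmas [multilinear] = scale_mult_left scale_mult_right

lemma antipode_linear_form [multilinear]: "S (x + y) = S x + S y" "S (s a x) = s a (S x)"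
  using antipode_linear by (auto simp: Vector_Spaces.linear_iff)

lemma sw2_comult_mult:
  assumes "bilinear_form s s \<phi>"
  shows "sw2 (\<Delta> (g * h)) \<phi> =
    sw2 (\<Delta> g) (\<lambda>g1 g2. sw2 (\<Delta> h) (\<lambda>h1 h2. \<phi> (g1 * h1) (g2 * h2)))"
proof -
  have "tensor (rel2 s s)
        (ttsum (rel2 s s) (\<lambda>(h1, h2). tpure (rel2 s s) (g1 * h1, g2 * h2)) (\<Delta> h))"
    and "bilinear_form s s \<phi> \<Longrightarrow>
        sw2 (ttsum (rel2 s s) (\<lambda>(h1, h2). tpure (rel2 s s) (g1 * h1, g2 * h2)) (\<Delta> h)) \<phi>
        = sw2 (\<Delta> h) (\<lambda>h1 h2. \<phi> (g1 * h1) (g2 * h2))" for g1 g2 \<phi>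
    by (rule sw2_ttsum_2[OF tensor_comult tensor_tpure sw2_tpure]; simp add: multilinear)+
  from sw2_ttsum_2(2)[OF tensor_comult this _ assms] show ?thesis
    unfolding comult_mult by (simp add: multilinear)
qed

lemma sw2_comult_one: "bilinear_form s s \<phi> \<Longrightarrow> sw2 (\<Delta> 1) \<phi> = \<phi> 1 1"
  by (simp add: comult_one sw2_tpure)

lemma sw2_antipode_left:
  assumes "linear_form s L"
  shows "sw2 (\<Delta> h) (\<lambda>h1 h2. L (S h1 * h2)) = \<epsilon> h * L 1"
proof -
  have "L (tsum s (\<lambda>(h1, h2). S h1 * h2) (\<Delta> h)) = sw2 (\<Delta> h) (\<lambda>h1 h2. L (S h1 * h2))"
    by (rule linear_form_tsum2[OF tensor_comult _ assms])
       (simp_all add: vector_space_axioms multilinear)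
  with assms show ?thesis by (simp add: antipode_left linear_form_def)
qed

lemma sw2_antipode_right:
  assumes "linear_form s L"
  shows "sw2 (\<Delta> h) (\<lambda>h1 h2. L (h1 * S h2)) = \<epsilon> h * L 1"
proof -
  have "L (tsum s (\<lambda>(h1, h2). h1 * S h2) (\<Delta> h)) = sw2 (\<Delta> h) (\<lambda>h1 h2. L (h1 * S h2))"
    by (rule linear_form_tsum2[OF tensor_comult _ assms])
       (simp_all add: vector_space_axioms multilinear)
  with assms show ?thesis by (simp add: antipode_right linear_form_def)
qed

end

context hopf_algebra
begin

lemma counit_antipode: "\<epsilon> (S h) = \<epsilon> h"
proof -
  have "\<epsilon> h = sw2 (\<Delta> h) (\<lambda>h1 h2. \<epsilon> (S h1 * h2))"
    using sw2_antipode_left[of \<epsilon> h] by (simp add: multilinear counit_one)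
  also have "\<dots> = sw2 (\<Delta> h) (\<lambda>h1 h2. \<epsilon> h2 * \<epsilon> (S h1))"
    by (simp add: counit_mult mult.commute)
  also have "\<dots> = \<epsilon> (S h)"
    by (rule sw2_counit_right) (simp add: multilinear)
  finally show ?thesis by simp
qed

text \<open>
  The identity \<open>S(h\<^sub>1) h\<^sub>2 \<otimes> h\<^sub>3 = 1 \<otimes> h\<close>: after rebracketing, the antipode law turns the first factor
  into a counit, which the remaining leg absorbs.
\<close>

lemma sw2_cancel_left:
  assumes "bilinear_form s s \<phi>"
  shows "sw2 (\<Delta> h) (\<lambda>h1 u. sw2 (\<Delta> u) (\<lambda>h2 h3. \<phi> (S h1 * h2) h3)) = \<phi> 1 h"
proof -
  have "sw2 (\<Delta> h) (\<lambda>h1 u. sw2 (\<Delta> u) (\<lambda>h2 h3. \<phi> (S h1 * h2) h3))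
      = sw2 (\<Delta> h) (\<lambda>u h3. sw2 (\<Delta> u) (\<lambda>h1 h2. \<phi> (S h1 * h2) h3))"
    using assms by (subst sw2_coassoc[symmetric]) (simp_all add: multilinear)
  also have "\<dots> = sw2 (\<Delta> h) (\<lambda>u h3. \<epsilon> u * \<phi> 1 h3)"
    using assms by (simp add: sw2_antipode_left[of "\<lambda>w. \<phi> w h3" for h3] multilinear)
  also have "\<dots> = \<phi> 1 h"
    using assms by (intro sw2_counit_left) (simp add: multilinear)
  finally show ?thesis .
qed

text \<open>
  The identity \<open>h\<^sub>1 \<otimes> h\<^sub>2 S(h\<^sub>3) = h \<otimes> 1\<close>, for which the sum is already bracketed as the antipode law
  requires.
\<close>

lemma sw2_cancel_right:
  assumes "bilinear_form s s \<phi>"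
  shows "sw2 (\<Delta> h) (\<lambda>h1 u. sw2 (\<Delta> u) (\<lambda>h2 h3. \<phi> h1 (h2 * S h3))) = \<phi> h 1"
proof -
  have "sw2 (\<Delta> h) (\<lambda>h1 u. sw2 (\<Delta> u) (\<lambda>h2 h3. \<phi> h1 (h2 * S h3)))
      = sw2 (\<Delta> h) (\<lambda>h1 u. \<epsilon> u * \<phi> h1 1)"
    using assms by (simp add: sw2_antipode_right[of "\<lambda>w. \<phi> h1 w" for h1] multilinear)
  also have "\<dots> = \<phi> h 1"
    using assms by (intro sw2_counit_right[of "\<lambda>x. \<phi> x 1"]) (simp add: multilinear)
  finally show ?thesis .
qed

text \<open>
  Evaluate \<open>S(g\<^sub>1 h\<^sub>1) g\<^sub>2 h\<^sub>2 S(h\<^sub>3) S(g\<^sub>3)\<close> in two ways.  Cancelling \<open>h\<^sub>2 S(h\<^sub>3)\<close> and then \<open>g\<^sub>2 S(g\<^sub>3)\<close> leaves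
  \<open>S(g h)\<close>; cancelling \<open>S(g\<^sub>1 h\<^sub>1) g\<^sub>2 h\<^sub>2\<close>, the antipode law for the product \<open>g h\<close>, leaves \<open>S(h) S(g)\<close>.
\<close>

lemma antipode_mult: "S (g * h) = S h * S g"
proof (rule eq_if_linear_forms_eq[OF vector_space_axioms])
  fix L assume L: "linear_form s L"
  let ?E = "sw2 (\<Delta> g) (\<lambda>g1 u. sw2 (\<Delta> u) (\<lambda>g2 g3.
    sw2 (\<Delta> h) (\<lambda>h1 v. sw2 (\<Delta> v) (\<lambda>h2 h3. L (S (g1 * h1) * (g2 * (h2 * S h3)) * S g3)))))"
  have "?E = sw2 (\<Delta> g) (\<lambda>g1 u. sw2 (\<Delta> u) (\<lambda>g2 g3. L (S (g1 * h) * g2 * S g3)))"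
    using L by (simp add: sw2_cancel_right[of "\<lambda>x w. L (S (g1 * x) * (g2 * w) * S g3)" for g1 g2 g3]
      multilinear)
  also have "\<dots> = L (S (g * h))"
    using L by (simp add: sw2_cancel_right[of "\<lambda>x w. L (S (x * h) * w)"] multilinear mult.assoc)
  finally have left: "?E = L (S (g * h))" .
  have "?E = sw2 (\<Delta> g) (\<lambda>g1 u. sw2 (\<Delta> u) (\<lambda>g2 g3.
      sw2 (\<Delta> h) (\<lambda>v h3. sw2 (\<Delta> v) (\<lambda>h1 h2. L (S (g1 * h1) * (g2 * h2) * (S h3 * S g3))))))"
    using L by (subst sw2_coassoc) (simp_all add: multilinear mult.assoc)
  also have "\<dots> = sw2 (\<Delta> g) (\<lambda>u g3. sw2 (\<Delta> u) (\<lambda>g1 g2.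
      sw2 (\<Delta> h) (\<lambda>v h3. sw2 (\<Delta> v) (\<lambda>h1 h2. L (S (g1 * h1) * (g2 * h2) * (S h3 * S g3))))))"
    using L by (subst sw2_coassoc[symmetric]) (simp_all add: multilinear)
  also have "\<dots> = sw2 (\<Delta> g) (\<lambda>u g3. sw2 (\<Delta> h) (\<lambda>v h3. sw2 (\<Delta> u) (\<lambda>g1 g2.
      sw2 (\<Delta> v) (\<lambda>h1 h2. L (S (g1 * h1) * (g2 * h2) * (S h3 * S g3))))))"
    by (subst (2) sw2_swap) (rule refl)
  also have "\<dots> = sw2 (\<Delta> g) (\<lambda>u g3. sw2 (\<Delta> h) (\<lambda>v h3.
      sw2 (\<Delta> (u * v)) (\<lambda>a b. L (S a * b * (S h3 * S g3)))))"
    using L by (simp add: sw2_comult_mult multilinear)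
  also have "\<dots> = sw2 (\<Delta> g) (\<lambda>u g3. \<epsilon> u * sw2 (\<Delta> h) (\<lambda>v h3. \<epsilon> v * L (S h3 * S g3)))"
    using L by (simp add: sw2_antipode_left[of "\<lambda>w. L (w * (S h3 * S g3))" for h3 g3] multilinear
      counit_mult mult.assoc[of "\<epsilon> u" for u])
  also have "\<dots> = sw2 (\<Delta> g) (\<lambda>u g3. \<epsilon> u * L (S h * S g3))"
    using L by (simp add: sw2_counit_left[of "\<lambda>x. L (S x * S g3)" for g3] multilinear)
  also have "\<dots> = L (S h * S g)"
    using L by (simp add: sw2_counit_left[of "\<lambda>x. L (S h * S x)"] multilinear)
  finally show "L (S (g * h)) = L (S h * S g)" using left by simp
qed

text \<open>
  That is, \<open>\<Delta>(S(h)) = S(h\<^sub>2) \<otimes> S(h\<^sub>1)\<close>.  Evaluate \<open>\<Delta>(S(h\<^sub>1)) \<Delta>(h\<^sub>2) (S(h\<^sub>4) \<otimes> S(h\<^sub>3))\<close> in two ways.  The first two factors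
  combine to \<open>\<Delta>(S(h\<^sub>1) h\<^sub>2)\<close> and cancel, leaving \<open>S(h\<^sub>2) \<otimes> S(h\<^sub>1)\<close>; the last two, with \<open>\<Delta>(h\<^sub>2)\<close> written out,
  cancel from the inside, leaving \<open>\<Delta>(S(h))\<close>.
\<close>

lemma sw2_comult_antipode:
  assumes "bilinear_form s s \<phi>"
  shows "sw2 (\<Delta> (S h)) \<phi> = sw2 (\<Delta> h) (\<lambda>h1 h2. \<phi> (S h2) (S h1))"
proof -
  let ?E = "sw2 (\<Delta> h) (\<lambda>h1 u. sw2 (\<Delta> u) (\<lambda>h2 v. sw2 (\<Delta> v) (\<lambda>h3 h4.
    sw2 (\<Delta> (S h1)) (\<lambda>p q. sw2 (\<Delta> h2) (\<lambda>a b. \<phi> (p * (a * S h4)) (q * (b * S h3)))))))"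
  have "?E = sw2 (\<Delta> h) (\<lambda>h1 u. sw2 (\<Delta> u) (\<lambda>h2 v. sw2 (\<Delta> v) (\<lambda>h3 h4.
    sw2 (\<Delta> (S h1 * h2)) (\<lambda>a b. \<phi> (a * S h4) (b * S h3)))))"
    using assms by (simp add: sw2_comult_mult multilinear mult.assoc)
  also have "\<dots> = sw2 (\<Delta> h) (\<lambda>h3 h4. sw2 (\<Delta> 1) (\<lambda>a b. \<phi> (a * S h4) (b * S h3)))"
    using assms by (subst sw2_cancel_left[of "\<lambda>w v. sw2 (\<Delta> v) (\<lambda>h3 h4.
      sw2 (\<Delta> w) (\<lambda>a b. \<phi> (a * S h4) (b * S h3)))"]) (simp_all add: multilinear)
  also have "\<dots> = sw2 (\<Delta> h) (\<lambda>h1 h2. \<phi> (S h2) (S h1))"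
    using assms by (simp add: sw2_comult_one multilinear)
  finally have left: "?E = sw2 (\<Delta> h) (\<lambda>h1 h2. \<phi> (S h2) (S h1))" .
  \<comment> \<open>\<open>\<Delta>(u\<^sub>1) (S(u\<^sub>3) \<otimes> S(u\<^sub>2)) = \<epsilon>(u) 1 \<otimes> 1\<close>: first \<open>b S(h\<^sub>3)\<close> cancels, then \<open>a S(h\<^sub>4)\<close>\<close>
  have collapse: "sw2 (\<Delta> u) (\<lambda>h2 v. sw2 (\<Delta> v) (\<lambda>h3 h4. sw2 (\<Delta> h2) (\<lambda>a b.
      \<xi> (a * S h4) (b * S h3)))) = \<epsilon> u * \<xi> 1 1"
    if \<xi>: "bilinear_form s s \<xi>" for \<xi> u
  proof -
    have "sw2 (\<Delta> u) (\<lambda>h2 v. sw2 (\<Delta> v) (\<lambda>h3 h4. sw2 (\<Delta> h2) (\<lambda>a b. \<xi> (a * S h4) (b * S h3))))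
        = sw2 (\<Delta> u) (\<lambda>h2 v. sw2 (\<Delta> h2) (\<lambda>a b. sw2 (\<Delta> v) (\<lambda>h3 h4. \<xi> (a * S h4) (b * S h3))))"
      by (subst sw2_swap) (rule refl)
    also have "\<dots> = sw2 (\<Delta> u) (\<lambda>a t. sw2 (\<Delta> t) (\<lambda>b v. sw2 (\<Delta> v) (\<lambda>h3 h4. \<xi> (a * S h4) (b * S h3))))"
      using \<xi> by (subst sw2_coassoc) (simp_all add: multilinear)
    also have "\<dots> = sw2 (\<Delta> u) (\<lambda>a t. sw2 (\<Delta> t) (\<lambda>v h4. sw2 (\<Delta> v) (\<lambda>b h3. \<xi> (a * S h4) (b * S h3))))"
      using \<xi> by (subst (2) sw2_coassoc[symmetric]) (simp_all add: multilinear)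
    also have "\<dots> = sw2 (\<Delta> u) (\<lambda>a t. sw2 (\<Delta> t) (\<lambda>v h4. \<epsilon> v * \<xi> (a * S h4) 1))"
      using \<xi> by (simp add: sw2_antipode_right[of "\<lambda>w. \<xi> (a * S h4) w" for a h4] multilinear)
    also have "\<dots> = sw2 (\<Delta> u) (\<lambda>a t. \<xi> (a * S t) 1)"
      using \<xi> by (simp add: sw2_counit_left[of "\<lambda>w. \<xi> (a * S w) 1" for a] multilinear)
    also have "\<dots> = \<epsilon> u * \<xi> 1 1"
      using \<xi> by (simp add: sw2_antipode_right[of "\<lambda>w. \<xi> w 1"] multilinear)
    finally show ?thesis .
  qed
  have "?E = sw2 (\<Delta> h) (\<lambda>h1 u. sw2 (\<Delta> (S h1)) (\<lambda>p q. sw2 (\<Delta> u) (\<lambda>h2 v. sw2 (\<Delta> v) (\<lambda>h3 h4.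
      sw2 (\<Delta> h2) (\<lambda>a b. \<phi> (p * (a * S h4)) (q * (b * S h3)))))))"
    by (simp only: sw2_swap[of "\<Delta> v" "\<Delta> (S h1)" for v h1])
  also have "\<dots> = sw2 (\<Delta> h) (\<lambda>h1 u. \<epsilon> u * sw2 (\<Delta> (S h1)) \<phi>)"
    using assms by (simp add: collapse[of "\<lambda>x y. \<phi> (p * x) (q * y)" for p q] multilinear)
  also have "\<dots> = sw2 (\<Delta> (S h)) \<phi>"
    using assms by (intro sw2_counit_right) (simp add: multilinear)
  finally show ?thesis using left by simp
qed

end

section \<open>Module coalgebras\<close>

context module_coalgebra
begin

lemma act_linear_form [multilinear]:
  "act (c + d) h = act c h + act d h" "act (sC a c) h = sC a (act c h)"
  "act c (h + g) = act c h + act c g" "act c (sH a h) = sC a (act c h)"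
  using act_linear_left act_linear_right by (auto simp: Vector_Spaces.linear_iff)

lemma sw2_comult_act:
  assumes "bilinear_form sC sC \<phi>"
  shows "sw2 (\<Delta>C (act c h)) \<phi> =
    sw2 (\<Delta>C c) (\<lambda>c1 c2. sw2 (\<Delta>H h) (\<lambda>h1 h2. \<phi> (act c1 h1) (act c2 h2)))"
proof -
  have "tensor (rel2 sC sC)
        (ttsum (rel2 sC sC) (\<lambda>(h1, h2). tpure (rel2 sC sC) (act c1 h1, act c2 h2)) (\<Delta>H h))"
    and "bilinear_form sC sC \<phi> \<Longrightarrow>
        sw2 (ttsum (rel2 sC sC) (\<lambda>(h1, h2). tpure (rel2 sC sC) (act c1 h1, act c2 h2)) (\<Delta>H h)) \<phi>
        = sw2 (\<Delta>H h) (\<lambda>h1 h2. \<phi> (act c1 h1) (act c2 h2))" for c1 c2 \<phi>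
    by (rule sw2_ttsum_2[OF tensor_comult tensor_tpure sw2_tpure]; simp add: multilinear)+
  from sw2_ttsum_2(2)[OF C.tensor_comult this _ assms] show ?thesis
    unfolding comult_act by (simp add: multilinear)
qed

lemma sw3_comult3_act:
  assumes "trilinear_form sC sC sC \<phi>"
  shows "sw3 (comult3 sC \<Delta>C (act c h)) \<phi> =
    sw3 (comult3 sC \<Delta>C c) (\<lambda>x y z. sw3 (comult3 sH \<Delta>H h) (\<lambda>h1 h2 h3.
      \<phi> (act x h1) (act y h2) (act z h3)))"
proof -
  have "sw3 (comult3 sC \<Delta>C (act c h)) \<phi> =
      sw2 (\<Delta>C c) (\<lambda>w z. sw2 (\<Delta>H h) (\<lambda>u h3. sw2 (\<Delta>C w) (\<lambda>x y. sw2 (\<Delta>H u) (\<lambda>h1 h2.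
        \<phi> (act x h1) (act y h2) (act z h3)))))"
    using assms by (simp add: C.sw3_comult3 sw2_comult_act multilinear)
  also have "\<dots> = sw2 (\<Delta>C c) (\<lambda>w z. sw2 (\<Delta>C w) (\<lambda>x y. sw2 (\<Delta>H h) (\<lambda>u h3. sw2 (\<Delta>H u) (\<lambda>h1 h2.
        \<phi> (act x h1) (act y h2) (act z h3)))))"
    by (subst sw2_swap) (rule refl)
  also have "\<dots> = sw3 (comult3 sC \<Delta>C c) (\<lambda>x y z. sw3 (comult3 sH \<Delta>H h) (\<lambda>h1 h2 h3.
      \<phi> (act x h1) (act y h2) (act z h3)))"
    using assms by (simp add: C.sw3_comult3 sw3_comult3 multilinear)
  finally show ?thesis .
qed

end


section \<open>The coaction induced by a total cointegral\<close>

locale coalgebra_cointegral =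
  module_coalgebra sH \<Delta>H \<epsilon>H S sC \<Delta>C \<epsilon>C act
  for sH :: "'k::field \<Rightarrow> 'h \<Rightarrow> 'h::ring_1"
    and \<Delta>H :: "'h \<Rightarrow> (('h \<times> 'h) \<Rightarrow>\<^sub>0 'k) set"
    and \<epsilon>H :: "'h \<Rightarrow> 'k"
    and S :: "'h \<Rightarrow> 'h"
    and sC :: "'k \<Rightarrow> 'c \<Rightarrow> 'c::ab_group_add"
    and \<Delta>C :: "'c \<Rightarrow> (('c \<times> 'c) \<Rightarrow>\<^sub>0 'k) set"
    and \<epsilon>C :: "'c \<Rightarrow> 'k"
    and act :: "'c \<Rightarrow> 'h \<Rightarrow> 'c" +
  fixes f :: "'c \<Rightarrow> 'h"
  assumes cointegral: "total_cointegral sH \<epsilon>H sC \<epsilon>C act f"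
    and coalg_map: "coalgebra_map sC \<Delta>C \<epsilon>C sH \<Delta>H \<epsilon>H f"
begin

lemma f_linear_form [multilinear]: "f (c + d) = f c + f d" "f (sC a c) = sH a (f c)"
  using coalg_map by (auto simp: coalgebra_map_def Vector_Spaces.linear_iff)

lemma counit_f: "\<epsilon>H (f c) = \<epsilon>C c"
  and f_act: "f (act c h) = f c * h"
  using cointegral by (auto simp: total_cointegral_def)

lemma sw2_comult_f:
  assumes "bilinear_form sH sH \<phi>"
  shows "sw2 (\<Delta>H (f c)) \<phi> = sw2 (\<Delta>C c) (\<lambda>c1 c2. \<phi> (f c1) (f c2))"
proof -
  have "\<Delta>H (f c) = ttsum (rel2 sH sH) (\<lambda>(c1, c2). tpure (rel2 sH sH) (f c1, f c2)) (\<Delta>C c)"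
    using coalg_map by (simp add: coalgebra_map_def)
  moreover have "sw2 (ttsum (rel2 sH sH) (\<lambda>(c1, c2). tpure (rel2 sH sH) (f c1, f c2)) (\<Delta>C c)) \<phi>
      = sw2 (\<Delta>C c) (\<lambda>c1 c2. \<phi> (f c1) (f c2))"
    by (rule sw2_ttsum_2(2)[OF C.tensor_comult tensor_tpure sw2_tpure]; (fact assms | simp add: multilinear))
  ultimately show ?thesis by simp
qed

lemma convolution_inverse_antipode: "convolution_inverse sC \<Delta>C \<epsilon>C sH f (S \<circ> f)"
proof -
  have "L (tsum sH (\<lambda>(c1, c2). f c1 * S (f c2)) (\<Delta>C c)) = L (sH (\<epsilon>C c) 1)"
    and "L (tsum sH (\<lambda>(c1, c2). S (f c1) * f c2) (\<Delta>C c)) = L (sH (\<epsilon>C c) 1)"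
    if L: "linear_form sH L" for L c
  proof -
    have "L (tsum sH (\<lambda>(c1, c2). f c1 * S (f c2)) (\<Delta>C c)) = sw2 (\<Delta>C c) (\<lambda>c1 c2. L (f c1 * S (f c2)))"
      by (rule linear_form_tsum2[OF C.tensor_comult vector_space_axioms L]) (simp add: multilinear)
    also have "\<dots> = sw2 (\<Delta>H (f c)) (\<lambda>x y. L (x * S y))"
      using L by (simp add: sw2_comult_f multilinear)
    also have "\<dots> = L (sH (\<epsilon>C c) 1)"
      using L by (simp add: sw2_antipode_right counit_f) (simp add: linear_form_def)
    finally show "L (tsum sH (\<lambda>(c1, c2). f c1 * S (f c2)) (\<Delta>C c)) = L (sH (\<epsilon>C c) 1)" .
    have "L (tsum sH (\<lambda>(c1, c2). S (f c1) * f c2) (\<Delta>C c)) = sw2 (\<Delta>C c) (\<lambda>c1 c2. L (S (f c1) * f c2))"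
      by (rule linear_form_tsum2[OF C.tensor_comult vector_space_axioms L]) (simp add: multilinear)
    also have "\<dots> = sw2 (\<Delta>H (f c)) (\<lambda>x y. L (S x * y))"
      using L by (simp add: sw2_comult_f multilinear)
    also have "\<dots> = L (sH (\<epsilon>C c) 1)"
      using L by (simp add: sw2_antipode_left counit_f) (simp add: linear_form_def)
    finally show "L (tsum sH (\<lambda>(c1, c2). S (f c1) * f c2) (\<Delta>C c)) = L (sH (\<epsilon>C c) 1)" .
  qed
  then show ?thesis
    unfolding convolution_inverse_def
    by (auto simp: Vector_Spaces.linear_iff multilinear vector_space_axioms M.vector_space_axioms
        intro!: eq_if_linear_forms_eq[OF vector_space_axioms])
qed

definition coaction :: "'c \<Rightarrow> (('c \<times> 'h) \<Rightarrow>\<^sub>0 'k) set" where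
  "coaction c = ttsum (rel2 sC sH)
     (\<lambda>(c1, c2, c3). tpure (rel2 sC sH) (c2, (S \<circ> f) c1 * f c3)) (comult3 sC \<Delta>C c)"

lemma tensor_coaction: "tensor (rel2 sC sH) (coaction c)"
  and sw2_coaction: "bilinear_form sC sH \<phi> \<Longrightarrow>
    sw2 (coaction c) \<phi> = sw3 (comult3 sC \<Delta>C c) (\<lambda>c1 c2 c3. \<phi> c2 (S (f c1) * f c3))"
  unfolding coaction_def o_def
  by (rule sw2_ttsum_3[OF C.tensor_comult3 tensor_tpure sw2_tpure]; simp add: multilinear)+

lemma sw2_coaction_linear [multilinear]:
  assumes "bilinear_form sC sH \<phi>"
  shows "sw2 (coaction (c + d)) \<phi> = sw2 (coaction c) \<phi> + sw2 (coaction d) \<phi>"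
    and "sw2 (coaction (sC a c)) \<phi> = a * sw2 (coaction c) \<phi>"
  using assms by (simp_all add: sw2_coaction) (simp_all add: C.sw3_comult3 multilinear)

lemma coaction_linear: "linear_to_tensor sC (rel2 sC sH) coaction"
  by (simp add: sw2_linear_to_tensor tensor_coaction linear_form_def sw2_coaction_linear)

lemma coaction_counit: "tsum sC (\<lambda>(m0, m1). sC (\<epsilon>H m1) m0) (coaction c) = c"
proof (rule eq_if_linear_forms_eq[OF M.vector_space_axioms])
  fix L assume L: "linear_form sC L"
  have scaled: "linear_form sC (\<lambda>y. a * L y)" for a
    using L by (simp add: linear_form_def algebra_simps)
  have "L (tsum sC (\<lambda>(m0, m1). sC (\<epsilon>H m1) m0) (coaction c))
      = sw2 (coaction c) (\<lambda>m0 m1. L (sC (\<epsilon>H m1) m0))"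
    by (rule linear_form_tsum2[OF tensor_coaction M.vector_space_axioms L])
       (simp add: multilinear algebra_simps)
  also have "\<dots> = sw2 (coaction c) (\<lambda>m0 m1. \<epsilon>H m1 * L m0)"
    using L by (simp add: linear_form_def)
  also have "\<dots> = sw3 (comult3 sC \<Delta>C c) (\<lambda>x y z. \<epsilon>C x * (\<epsilon>C z * L y))"
    using L by (subst sw2_coaction)
      (simp_all add: multilinear algebra_simps counit_mult counit_antipode counit_f)
  also have "\<dots> = sw2 (\<Delta>C c) (\<lambda>w z. sw2 (\<Delta>C w) (\<lambda>x y. \<epsilon>C x * (\<epsilon>C z * L y)))"
    using L by (subst C.sw3_comult3) (simp_all add: multilinear algebra_simps)
  also have "\<dots> = sw2 (\<Delta>C c) (\<lambda>w z. \<epsilon>C z * L w)"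
    by (simp add: C.sw2_counit_left[OF scaled])
  also have "\<dots> = L c"
    by (rule C.sw2_counit_right[OF L])
  finally show "L (tsum sC (\<lambda>(m0, m1). sC (\<epsilon>H m1) m0) (coaction c)) = L c" .
qed

text \<open>
  Both sides expand to the fivefold sum of \<open>T c\<^sub>3 (S(f(c\<^sub>2)) f(c\<^sub>4)) (S(f(c\<^sub>1)) f(c\<^sub>5))\<close>, bracketed
  differently; coassociativity is applied until the bracketings agree.
\<close>

lemma sw2_coaction_coassoc:
  assumes T: "trilinear_form sC sH sH T"
  shows "sw2 (coaction m) (\<lambda>m0 m1. sw2 (coaction m0) (\<lambda>m00 m01. T m00 m01 m1))
    = sw2 (coaction m) (\<lambda>m0 m1. sw2 (\<Delta>H m1) (\<lambda>h1 h2. T m0 h1 h2))"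
proof -
  \<comment> \<open>\<open>a, \<dots>, e\<close> stand for \<open>c\<^sub>1, \<dots>, c\<^sub>5\<close>\<close>
  let ?U = "\<lambda>a b c d e. T c (S (f b) * f d) (S (f a) * f e)"
  have "sw2 (coaction m) (\<lambda>m0 m1. sw2 (coaction m0) (\<lambda>m00 m01. T m00 m01 m1))
      = sw2 (\<Delta>C m) (\<lambda>w e. sw2 (\<Delta>C w) (\<lambda>a u. sw2 (\<Delta>C u) (\<lambda>v d. sw2 (\<Delta>C v) (\<lambda>b c.
          ?U a b c d e))))"
    using T by (simp add: sw2_coaction C.sw3_comult3 multilinear)
  also have "\<dots> = sw2 (\<Delta>C m) (\<lambda>w e. sw2 (\<Delta>C w) (\<lambda>u d. sw2 (\<Delta>C u) (\<lambda>a v. sw2 (\<Delta>C v) (\<lambda>b c.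
          ?U a b c d e))))"
    using T by (subst (2) C.sw2_coassoc) (simp_all add: multilinear)
  also have "\<dots> = sw2 (\<Delta>C m) (\<lambda>u v. sw2 (\<Delta>C v) (\<lambda>d e. sw2 (\<Delta>C u) (\<lambda>a w. sw2 (\<Delta>C w) (\<lambda>b c.
          ?U a b c d e))))"
    using T by (subst C.sw2_coassoc) (simp_all add: multilinear)
  also have "\<dots> = sw2 (\<Delta>C m) (\<lambda>u v. sw2 (\<Delta>C v) (\<lambda>d e. sw2 (\<Delta>C u) (\<lambda>w c. sw2 (\<Delta>C w) (\<lambda>a b.
          ?U a b c d e))))"
    using T by (subst (2) C.sw2_coassoc[symmetric]) (simp_all add: multilinear)
  also have "\<dots> = sw2 (\<Delta>C m) (\<lambda>u v. sw2 (\<Delta>C u) (\<lambda>w c. sw2 (\<Delta>C w) (\<lambda>a b. sw2 (\<Delta>C v) (\<lambda>d e.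
          ?U a b c d e))))"
    by (subst sw2_swap, subst (2) sw2_swap, rule refl)
  \<comment> \<open>the outer pairs \<open>a, b\<close> and \<open>d, e\<close> now come from single elements \<open>w\<close> and \<open>v\<close>, so that \<open>f\<close> can be moved
      inside their comultiplications\<close>
  also have "\<dots> = sw3 (comult3 sC \<Delta>C m) (\<lambda>w c v. sw2 (\<Delta>H (f w)) (\<lambda>p q. sw2 (\<Delta>H (f v)) (\<lambda>x y.
          T c (S q * x) (S p * y))))"
    using T by (simp add: C.sw3_comult3 sw2_comult_f multilinear)
  also have "\<dots> = sw3 (comult3 sC \<Delta>C m) (\<lambda>w c v. sw2 (\<Delta>H (S (f w) * f v)) (\<lambda>h1 h2. T c h1 h2))"
    using T by (simp add: sw2_comult_mult sw2_comult_antipode multilinear)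
  also have "\<dots> = sw2 (coaction m) (\<lambda>m0 m1. sw2 (\<Delta>H m1) (\<lambda>h1 h2. T m0 h1 h2))"
    using T by (simp add: sw2_coaction multilinear)
  finally show ?thesis .
qed

lemma coaction_coassoc:
  "ttsum (rel3 sC sH sH)
     (\<lambda>(m0, m1). ttsum (rel3 sC sH sH) (\<lambda>(m00, m01). tpure (rel3 sC sH sH) (m00, m01, m1)) (coaction m0))
     (coaction m)
   = ttsum (rel3 sC sH sH)
     (\<lambda>(m0, m1). ttsum (rel3 sC sH sH) (\<lambda>(h1, h2). tpure (rel3 sC sH sH) (m0, h1, h2)) (\<Delta>H m1))
     (coaction m)" (is "?l = ?r")
proof -
  have l: "tensor (rel3 sC sH sH)
      (ttsum (rel3 sC sH sH) (\<lambda>(m00, m01). tpure (rel3 sC sH sH) (m00, m01, m1)) (coaction m0))"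
    "trilinear_form sC sH sH T \<Longrightarrow>
      sw3 (ttsum (rel3 sC sH sH) (\<lambda>(m00, m01). tpure (rel3 sC sH sH) (m00, m01, m1)) (coaction m0)) T
      = sw2 (coaction m0) (\<lambda>m00 m01. T m00 m01 m1)" for m0 m1 T
    by (rule sw3_ttsum_2[OF tensor_coaction tensor_tpure sw3_tpure]; simp add: multilinear)+
  have r: "tensor (rel3 sC sH sH)
      (ttsum (rel3 sC sH sH) (\<lambda>(h1, h2). tpure (rel3 sC sH sH) (m0, h1, h2)) (\<Delta>H m1))"
    "trilinear_form sC sH sH T \<Longrightarrow>
      sw3 (ttsum (rel3 sC sH sH) (\<lambda>(h1, h2). tpure (rel3 sC sH sH) (m0, h1, h2)) (\<Delta>H m1)) T
      = sw2 (\<Delta>H m1) (\<lambda>h1 h2. T m0 h1 h2)" for m0 m1 T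
    by (rule sw3_ttsum_2[OF tensor_comult tensor_tpure sw3_tpure]; simp add: multilinear)+
  have l': "tensor (rel3 sC sH sH) ?l"
    "trilinear_form sC sH sH T \<Longrightarrow>
      sw3 ?l T = sw2 (coaction m) (\<lambda>m0 m1. sw2 (coaction m0) (\<lambda>m00 m01. T m00 m01 m1))" for T
    by (rule sw3_ttsum_2[OF tensor_coaction l]; simp add: multilinear)+
  have r': "tensor (rel3 sC sH sH) ?r"
    "trilinear_form sC sH sH T \<Longrightarrow>
      sw3 ?r T = sw2 (coaction m) (\<lambda>m0 m1. sw2 (\<Delta>H m1) (\<lambda>h1 h2. T m0 h1 h2))" for T
    by (rule sw3_ttsum_2[OF tensor_coaction r]; simp add: multilinear)+
  show ?thesis
    by (rule tensor3_eqI[OF l'(1) r'(1)]) (simp only: l' r' sw2_coaction_coassoc)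
qed

text \<open>
  Comultiplying \<open>m h\<close> gives \<open>S(f(m\<^sub>1 h\<^sub>1)) f(m\<^sub>3 h\<^sub>3)\<close> in the second factor; \<open>f\<close> is \<open>H\<close>-linear and \<open>S\<close> reverses
  products, so \<open>h\<^sub>1\<close> and \<open>h\<^sub>3\<close> move to the two ends.
\<close>

lemma coaction_act:
  "coaction (act m h) =
     ttsum (rel2 sC sH)
       (\<lambda>(m0, m1). ttsum (rel2 sC sH)
         (\<lambda>(h1, h2, h3). tpure (rel2 sC sH) (act m0 h2, S h1 * m1 * h3)) (comult3 sH \<Delta>H h))
       (coaction m)" (is "_ = ?r")
proof -
  have i: "tensor (rel2 sC sH) (ttsum (rel2 sC sH)
      (\<lambda>(h1, h2, h3). tpure (rel2 sC sH) (act m0 h2, S h1 * m1 * h3)) (comult3 sH \<Delta>H h))"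
    "bilinear_form sC sH \<phi> \<Longrightarrow> sw2 (ttsum (rel2 sC sH)
      (\<lambda>(h1, h2, h3). tpure (rel2 sC sH) (act m0 h2, S h1 * m1 * h3)) (comult3 sH \<Delta>H h)) \<phi>
      = sw3 (comult3 sH \<Delta>H h) (\<lambda>h1 h2 h3. \<phi> (act m0 h2) (S h1 * m1 * h3))" for m0 m1 \<phi>
    by (rule sw2_ttsum_3[OF tensor_comult3 tensor_tpure sw2_tpure]; simp add: multilinear)+
  have r: "tensor (rel2 sC sH) ?r"
    "bilinear_form sC sH \<phi> \<Longrightarrow> sw2 ?r \<phi> = sw2 (coaction m) (\<lambda>m0 m1.
      sw3 (comult3 sH \<Delta>H h) (\<lambda>h1 h2 h3. \<phi> (act m0 h2) (S h1 * m1 * h3)))" for \<phi>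
    by (rule sw2_ttsum_2[OF tensor_coaction i]; simp add: multilinear)+
  show ?thesis
  proof (rule tensor2_eqI[OF tensor_coaction r(1)])
    fix \<phi> assume \<phi>: "bilinear_form sC sH \<phi>"
    have "sw2 (coaction (act m h)) \<phi> =
        sw3 (comult3 sC \<Delta>C m) (\<lambda>x y z. sw3 (comult3 sH \<Delta>H h) (\<lambda>h1 h2 h3.
          \<phi> (act y h2) (S h1 * (S (f x) * f z) * h3)))"
      using \<phi> by (simp add: sw2_coaction sw3_comult3_act multilinear f_act antipode_mult mult.assoc)
    also have "\<dots> = sw2 ?r \<phi>"
      using \<phi> by (simp add: r(2)) (simp add: sw2_coaction multilinear)
    finally show "sw2 (coaction (act m h)) \<phi> = sw2 ?r \<phi>" .
  qed
qed

lemma yetter_drinfeld_coaction: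
  "right_right_yetter_drinfeld sH \<Delta>H \<epsilon>H S sC act coaction"
  by unfold_locales (rule coaction_linear coaction_coassoc coaction_counit coaction_act)+

end

theorem proposition3p19:
  fixes sH :: "'k::field \<Rightarrow> 'h \<Rightarrow> 'h::ring_1"
    and \<Delta>H :: "'h \<Rightarrow> (('h \<times> 'h) \<Rightarrow>\<^sub>0 'k) set"
    and \<epsilon>H :: "'h \<Rightarrow> 'k"
    and S :: "'h \<Rightarrow> 'h"
    and sC :: "'k \<Rightarrow> 'c \<Rightarrow> 'c::ab_group_add"
    and \<Delta>C :: "'c \<Rightarrow> (('c \<times> 'c) \<Rightarrow>\<^sub>0 'k) set"
    and \<epsilon>C :: "'c \<Rightarrow> 'k"
    and act :: "'c \<Rightarrow> 'h \<Rightarrow> 'c"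
    and f :: "'c \<Rightarrow> 'h"
  assumes "hopf_algebra sH \<Delta>H \<epsilon>H S"
    and "module_coalgebra sH \<Delta>H \<epsilon>H S sC \<Delta>C \<epsilon>C act"
    and "total_cointegral sH \<epsilon>H sC \<epsilon>C act f"
    and "coalgebra_map sC \<Delta>C \<epsilon>C sH \<Delta>H \<epsilon>H f"
  shows "convolution_inverse sC \<Delta>C \<epsilon>C sH f (S \<circ> f) \<and>
    right_right_yetter_drinfeld sH \<Delta>H \<epsilon>H S sC act
      (\<lambda>c. ttsum (rel2 sC sH)
             (\<lambda>(c1, c2, c3). tpure (rel2 sC sH) (c2, (S \<circ> f) c1 * f c3))
             (comult3 sC \<Delta>C c))"
proof -
  interpret coalgebra_cointegral sH \<Delta>H \<epsilon>H S sC \<Delta>C \<epsilon>C act f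
    using assms by (simp add: coalgebra_cointegral_def coalgebra_cointegral_axioms_def)
  show ?thesis
    using convolution_inverse_antipode yetter_drinfeld_coaction unfolding coaction_def by simp
qed

end
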